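(* Let $p$ be a prime, let $K\subset\mathbb{Q}_p$ be a field with $[K:\mathbb{Q}]=2$, let $z\in K$ satisfy condition (H) with $K=\mathbb{Q}(z)$, and let $\epsilon\in\{-1,1\}$. Let $T=T_{\epsilon,z}:K\to K$ be the map defined in the context. Then every rational number $\alpha$ has a finite expansion (i.e. $T^m(\alpha)=0$ for some $m\ge 0$), and every $\alpha\in K$ with $\alpha\notin\mathbb{Q}$ has a periodic expansion (i.e. $T^{m_1}(\alpha)=T^{m_2}(\alpha)$ for some integers $0\le m_1<m_2$).
   Context: Notation: For $\beta\in\mathbb{Q}_p\setminus\{0\}$ write $\beta=\sum_{n\in\mathbb{Z}}c_np^n$ with digits $c_n\in\{0,1,\dots,p-1\}$; $\mathrm{ord}_p(\beta)=\min\{n: c_n\neq 0\}$ ($\mathrm{ord}_p(0)=\infty$), $\omega_p(\beta):=c_0$ ($\omega_p(0)=0$), and $\langle\beta\rangle_p:=\sum_{n\ge 1}c_np^n$ ($\langle 0\rangle_p=0$). Condition (H): an element $\beta\in\mathbb{Q}_p$, algebraic over $\mathbb{Q}$, with $\beta\notin\mathbb{Q}$ and $\beta\in p\mathbb{Z}_p$, satisfies (H) if its minimal polynomial over $\mathbb{Q}$ is $x^n+a_1x^{n-1}+\dots+a_n$ with all $a_i\in\mathbb{Z}_p\cap\mathbb{Q}$, $\mathrm{ord}_p(a_{n-1})=0$ and $\mathrm{ord}_p(a_n)>0$. The map $T=T_{\epsilon,z}$ (the one-dimensional $\Phi_1^{[\epsilon,z]}$ algorithm): for $\alpha\in K$,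 put $g=\frac{\epsilon p^{\mathrm{ord}_p(\alpha)}}{\alpha}-\omega_p\!\left(\frac{\epsilon p^{\mathrm{ord}_p(\alpha)}}{\alpha}\right)$ if $\alpha\neq0$ and $g=0$ if $\alpha=0$. Write uniquely $g=a_0+a_1z$ with $a_0,a_1\in\mathbb{Q}$, let $a'$ be the largest positive integer coprime to $p$ dividing the numerator of $a_1$ (with $a'=1$ if $a_1=0$), and set $T(\alpha):=\frac{g}{a'}-\left\langle\frac{a_0}{a'}\right\rangle_p$. The expansion of $\alpha$ is the sequence $\alpha^{(0)}=\alpha$, $\alpha^{(n+1)}=T(\alpha^{(n)})$. *)

theory Defs
  imports
    "HOL-Analysis.Analysis"
    "HOL-Computational_Algebra.Polynomial"
    "HOL-Computational_Algebra.Primes"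
    "HOL-Library.Extended"
begin

section \<open>The \<open>p\<close>-adic absolute value on the rationals\<close>

definition rat_pval :: "nat \<Rightarrow> rat \<Rightarrow> int" where
  "rat_pval p r = int (multiplicity (int p) (fst (quotient_of r)))
                - int (multiplicity (int p) (snd (quotient_of r)))"

definition rat_pabs :: "nat \<Rightarrow> rat \<Rightarrow> real" where
  "rat_pabs p r = (if r = 0 then 0 else real p powi (- rat_pval p r))"

lemma rat_pval_divide:
  assumes p: "prime p" and a: "a \<noteq> 0" and b: "b \<noteq> 0"
  shows "rat_pval p (of_int a / of_int b) = int (multiplicity (int p) a) - int (multiplicity (int p) b)"
proof -
  obtain n d where q: "quotient_of (of_int a / of_int b) = (n, d)" by (cases "quotient_of (of_int a / of_int b)")
  have d: "d > 0" using quotient_of_denom_pos[OF q] .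
  have eq: "(of_int a / of_int b :: rat) = of_int n / of_int d" using quotient_of_div[OF q] .
  have "of_int (a * d) = (of_int (n * b) :: rat)"
    using eq b d by (simp add: field_simps)
  then have e: "a * d = n * b" by (simp only: of_int_eq_iff)
  have n: "n \<noteq> 0" using e a d by auto
  have pe: "prime_elem (int p)" using p by simp
  have "multiplicity (int p) a + multiplicity (int p) d = multiplicity (int p) n + multiplicity (int p) b"
    using prime_elem_multiplicity_mult_distrib[OF pe a, of d]
      prime_elem_multiplicity_mult_distrib[OF pe n b] d e by simp
  then show ?thesis unfolding rat_pval_def q by simp
qed

lemma rat_as_int_quotient:
  fixes x :: rat
  obtains a b :: int where "x = of_int a / of_int b" "b \<noteq> 0"
proof -
  obtain n d where q: "quotient_of x = (n, d)" by (cases "quotient_of x")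
  show thesis using that[of n d] quotient_of_denom_pos[OF q] quotient_of_div[OF q] by simp
qed

lemma rat_pval_mult:
  assumes p: "prime p" and x: "x \<noteq> 0" and y: "y \<noteq> 0"
  shows "rat_pval p (x * y) = rat_pval p x + rat_pval p y"
proof -
  obtain a b where xe: "x = of_int a / of_int b" and b: "b \<noteq> 0" by (rule rat_as_int_quotient)
  obtain c d where ye: "y = of_int c / of_int d" and d: "d \<noteq> 0" by (rule rat_as_int_quotient)
  have a: "a \<noteq> 0" and c: "c \<noteq> 0" using x y xe ye by auto
  have xy: "x * y = of_int (a * c) / of_int (b * d)" by (simp add: xe ye)
  have pe: "prime_elem (int p)" using p by simp
  have "rat_pval p (x * y) = int (multiplicity (int p) (a * c)) - int (multiplicity (int p) (b * d))"
    unfolding xy by (rule rat_pval_divide) (use p a b c d in auto)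
  then show ?thesis
    using rat_pval_divide[OF p a b] rat_pval_divide[OF p c d] xe ye
      prime_elem_multiplicity_mult_distrib[OF pe a c] prime_elem_multiplicity_mult_distrib[OF pe b d]
    by simp
qed

lemma rat_pval_minus:
  assumes p: "prime p"
  shows "rat_pval p (- x) = rat_pval p x"
proof (cases "x = 0")
  case False
  obtain a b where xe: "x = of_int a / of_int b" and b: "b \<noteq> 0" by (rule rat_as_int_quotient)
  have a: "a \<noteq> 0" using False xe by auto
  have "- x = of_int (- a) / of_int b" by (simp add: xe)
  then show ?thesis using rat_pval_divide[OF p a b] rat_pval_divide[OF p _ b, of "- a"] a xe
      multiplicity_times_unit_right[of "- 1" "int p" a] by simp
qed simp

lemma rat_pval_add:
  assumes p: "prime p" and x: "x \<noteq> 0" and y: "y \<noteq> 0" and xy: "x + y \<noteq> 0"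
  shows "min (rat_pval p x) (rat_pval p y) \<le> rat_pval p (x + y)"
proof -
  obtain a b where xe: "x = of_int a / of_int b" and b: "b \<noteq> 0" by (rule rat_as_int_quotient)
  obtain c d where ye: "y = of_int c / of_int d" and d: "d \<noteq> 0" by (rule rat_as_int_quotient)
  have a: "a \<noteq> 0" and c: "c \<noteq> 0" using x y xe ye by auto
  have xs: "x = of_int (a * d) / of_int (b * d)" and ys: "y = of_int (c * b) / of_int (b * d)"
    using b d by (simp_all add: xe ye)
  have s: "x + y = of_int (a * d + c * b) / of_int (b * d)"
    unfolding xs ys by (simp add: add_divide_distrib)
  have nz: "a * d + c * b \<noteq> 0" using xy s by (metis div_0 of_int_0)
  let ?m = "multiplicity (int p)"
  define k where "k = min (?m (a * d)) (?m (c * b))"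
  have "int p ^ k dvd a * d" "int p ^ k dvd c * b"
    unfolding k_def by (auto intro: multiplicity_dvd')
  then have "int p ^ k dvd a * d + c * b" by (rule dvd_add)
  then have "k \<le> ?m (a * d + c * b)"
    by (rule multiplicity_geI[rotated -1]) (use p nz in \<open>auto simp: prime_gt_1_nat\<close>)
  then show ?thesis
    using rat_pval_divide[OF p, of "a * d" "b * d"] rat_pval_divide[OF p, of "c * b" "b * d"]
      rat_pval_divide[OF p nz, of "b * d"] a b c d xs ys s unfolding k_def by simp
qed

lemma rat_pabs_0 [simp]: "rat_pabs p 0 = 0"
  by (simp add: rat_pabs_def)

lemma rat_pabs_pos: "prime p \<Longrightarrow> x \<noteq> 0 \<Longrightarrow> 0 < rat_pabs p x"
  by (simp add: rat_pabs_def prime_gt_0_nat)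

lemma rat_pabs_nonneg: "prime p \<Longrightarrow> 0 \<le> rat_pabs p x"
  by (simp add: rat_pabs_def)

lemma rat_pabs_eq_0: "prime p \<Longrightarrow> rat_pabs p x = 0 \<longleftrightarrow> x = 0"
  using rat_pabs_pos[of p x] by (cases "x = 0") auto

lemma rat_pabs_mult: "prime p \<Longrightarrow> rat_pabs p (x * y) = rat_pabs p x * rat_pabs p y"
  using power_int_add[of "real p" "- rat_pval p x" "- rat_pval p y"]
  by (auto simp: rat_pabs_def rat_pval_mult prime_gt_0_nat)

lemma rat_pabs_minus: "prime p \<Longrightarrow> rat_pabs p (- x) = rat_pabs p x"
  by (simp add: rat_pabs_def rat_pval_minus)

lemma rat_pabs_minus_commute: "prime p \<Longrightarrow> rat_pabs p (x - y) = rat_pabs p (y - x)"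
  using rat_pabs_minus[of p "x - y"] by simp

lemma rat_pabs_1: "prime p \<Longrightarrow> rat_pabs p 1 = 1"
  using rat_pabs_mult[of p 1 1] rat_pabs_pos[of p 1] by simp

lemma rat_pabs_inverse: "prime p \<Longrightarrow> rat_pabs p (inverse x) = inverse (rat_pabs p x)"
  using rat_pabs_mult[of p x "inverse x"] rat_pabs_1[of p]
  by (cases "x = 0") (simp_all add: inverse_unique)

lemma rat_pabs_add_max:
  assumes p: "prime p"
  shows "rat_pabs p (x + y) \<le> max (rat_pabs p x) (rat_pabs p y)"
proof (cases "x = 0 \<or> y = 0 \<or> x + y = 0")
  case True
  then show ?thesis using rat_pabs_nonneg[OF p] by (auto simp: le_max_iff_disj)
next
  case False
  then have "min (rat_pval p x) (rat_pval p y) \<le> rat_pval p (x + y)"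
    using rat_pval_add[OF p] by simp
  then have "rat_pval p x \<le> rat_pval p (x + y) \<or> rat_pval p y \<le> rat_pval p (x + y)" by linarith
  moreover have "1 \<le> real p" using prime_ge_1_nat[OF p] by linarith
  ultimately show ?thesis using False
    by (auto simp: rat_pabs_def le_max_iff_disj intro!: power_int_increasing)
qed

lemma rat_pabs_triangle: "prime p \<Longrightarrow> rat_pabs p (x + y) \<le> rat_pabs p x + rat_pabs p y"
  using rat_pabs_add_max[of p x y] rat_pabs_nonneg[of p x] rat_pabs_nonneg[of p y] by linarith

lemma rat_pabs_reverse_triangle:
  assumes p: "prime p"
  shows "\<bar>rat_pabs p x - rat_pabs p y\<bar> \<le> rat_pabs p (x - y)"
  using rat_pabs_triangle[OF p, of "x - y" y] rat_pabs_triangle[OF p, of "y - x" x]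
    rat_pabs_minus_commute[OF p, of x y] by simp


section \<open>\<open>p\<close>-adic Cauchy sequences of rationals\<close>

definition pvanishes :: "nat \<Rightarrow> (nat \<Rightarrow> rat) \<Rightarrow> bool" where
  "pvanishes p X \<longleftrightarrow> (\<lambda>n. rat_pabs p (X n)) \<longlonglongrightarrow> 0"

definition pcauchy :: "nat \<Rightarrow> (nat \<Rightarrow> rat) \<Rightarrow> bool" where
  "pcauchy p X \<longleftrightarrow> (\<forall>e>0. \<exists>k. \<forall>m\<ge>k. \<forall>n\<ge>k. rat_pabs p (X m - X n) < e)"

lemma pvanishes_const: "prime p \<Longrightarrow> pvanishes p (\<lambda>n. c) \<longleftrightarrow> c = 0"
  by (simp add: pvanishes_def LIMSEQ_const_iff rat_pabs_eq_0)

lemma pvanishes_bound: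
  assumes p: "prime p" and f: "f \<longlonglongrightarrow> 0" and "\<And>n. rat_pabs p (X n) \<le> f n"
  shows "pvanishes p X"
  unfolding pvanishes_def
  by (rule tendsto_sandwich[OF _ _ tendsto_const f]) (use assms rat_pabs_nonneg[OF p] in auto)

lemma pvanishes_minus: "prime p \<Longrightarrow> pvanishes p X \<Longrightarrow> pvanishes p (\<lambda>n. - X n)"
  by (simp add: pvanishes_def rat_pabs_minus)

lemma pvanishes_add:
  assumes "prime p" "pvanishes p X" "pvanishes p Y"
  shows "pvanishes p (\<lambda>n. X n + Y n)"
  by (rule pvanishes_bound[OF assms(1) _ rat_pabs_triangle])
    (use assms tendsto_add[of "\<lambda>n. rat_pabs p (X n)" 0 sequentially "\<lambda>n. rat_pabs p (Y n)" 0]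
      in \<open>auto simp: pvanishes_def\<close>)

lemma pvanishes_diff:
  assumes "prime p" "pvanishes p X" "pvanishes p Y"
  shows "pvanishes p (\<lambda>n. X n - Y n)"
  using pvanishes_add[OF assms(1,2) pvanishes_minus[OF assms(1,3)]] by simp

lemma pcauchy_const: "pcauchy p (\<lambda>n. c)"
  by (simp add: pcauchy_def)

lemma pcauchyD: "pcauchy p X \<Longrightarrow> 0 < e \<Longrightarrow> \<exists>k. \<forall>m\<ge>k. \<forall>n\<ge>k. rat_pabs p (X m - X n) < e"
  by (simp add: pcauchy_def)

lemma pcauchy_minus: "prime p \<Longrightarrow> pcauchy p X \<Longrightarrow> pcauchy p (\<lambda>n. - X n)"
  using rat_pabs_minus_commute[of p] by (simp add: pcauchy_def)

lemma pcauchy_add: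
  assumes p: "prime p" and X: "pcauchy p X" and Y: "pcauchy p Y"
  shows "pcauchy p (\<lambda>n. X n + Y n)"
  unfolding pcauchy_def
proof (intro allI impI)
  fix e :: real assume "e > 0"
  then obtain i j where i: "\<forall>m\<ge>i. \<forall>n\<ge>i. rat_pabs p (X m - X n) < e"
    and j: "\<forall>m\<ge>j. \<forall>n\<ge>j. rat_pabs p (Y m - Y n) < e"
    using pcauchyD[OF X] pcauchyD[OF Y] by meson
  have "rat_pabs p (X m + Y m - (X n + Y n)) < e" if "m \<ge> max i j" "n \<ge> max i j" for m n
  proof -
    have "rat_pabs p (X m - X n) < e" "rat_pabs p (Y m - Y n) < e" using i j that by auto
    then show ?thesis
      using rat_pabs_add_max[OF p, of "X m - X n" "Y m - Y n"] unfolding add_diff_add by linarith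
  qed
  then show "\<exists>k. \<forall>m\<ge>k. \<forall>n\<ge>k. rat_pabs p (X m + Y m - (X n + Y n)) < e" by blast
qed

lemma pcauchy_abs_Cauchy:
  assumes p: "prime p" and X: "pcauchy p X"
  shows "Cauchy (\<lambda>n. rat_pabs p (X n))"
proof (rule CauchyI)
  fix e :: real assume "e > 0"
  then obtain k where "\<forall>m\<ge>k. \<forall>n\<ge>k. rat_pabs p (X m - X n) < e" using pcauchyD[OF X] by blast
  then show "\<exists>M. \<forall>m\<ge>M. \<forall>n\<ge>M. norm (rat_pabs p (X m) - rat_pabs p (X n)) < e"
    using rat_pabs_reverse_triangle[OF p] by (metis order_le_less_trans real_norm_def)
qed

lemma pcauchy_abs_convergent:
  "prime p \<Longrightarrow> pcauchy p X \<Longrightarrow> convergent (\<lambda>n. rat_pabs p (X n))"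
  using pcauchy_abs_Cauchy by (simp add: Cauchy_convergent_iff)

lemma pcauchy_bounded:
  assumes p: "prime p" and X: "pcauchy p X"
  obtains b where "b > 0" "\<And>n. rat_pabs p (X n) \<le> b"
proof -
  have "Bseq (\<lambda>n. rat_pabs p (X n))"
    using pcauchy_abs_convergent[OF p X] convergent_imp_Bseq by blast
  then obtain K where "K > 0" "\<forall>n. norm (rat_pabs p (X n)) \<le> K" by (auto simp: Bseq_def)
  then show thesis using that[of K] by (simp add: abs_le_iff)
qed

lemma pvanishes_mult:
  assumes p: "prime p" and X: "pcauchy p X" and Y: "pvanishes p Y"
  shows "pvanishes p (\<lambda>n. X n * Y n)"
proof -
  obtain b where b: "b > 0" "\<And>n. rat_pabs p (X n) \<le> b" using pcauchy_bounded[OF p X] by blast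
  have "(\<lambda>n. b * rat_pabs p (Y n)) \<longlonglongrightarrow> 0"
    using Y tendsto_mult_left[of "\<lambda>n. rat_pabs p (Y n)" 0 sequentially b] by (simp add: pvanishes_def)
  then show ?thesis
    by (rule pvanishes_bound[OF p]) (simp add: rat_pabs_mult[OF p] mult_right_mono b rat_pabs_nonneg[OF p])
qed

lemma pcauchy_mult:
  assumes p: "prime p" and X: "pcauchy p X" and Y: "pcauchy p Y"
  shows "pcauchy p (\<lambda>n. X n * Y n)"
  unfolding pcauchy_def
proof (intro allI impI)
  fix e :: real assume e: "e > 0"
  obtain a where a: "a > 0" "\<And>n. rat_pabs p (X n) \<le> a" using pcauchy_bounded[OF p X] by blast
  obtain b where b: "b > 0" "\<And>n. rat_pabs p (Y n) \<le> b" using pcauchy_bounded[OF p Y] by blast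
  obtain i where i: "\<forall>m\<ge>i. \<forall>n\<ge>i. rat_pabs p (X m - X n) < e / b"
    using pcauchyD[OF X, of "e / b"] e b by auto
  obtain j where j: "\<forall>m\<ge>j. \<forall>n\<ge>j. rat_pabs p (Y m - Y n) < e / a"
    using pcauchyD[OF Y, of "e / a"] e a by auto
  have "rat_pabs p (X m * Y m - X n * Y n) < e" if mn: "m \<ge> max i j" "n \<ge> max i j" for m n
  proof -
    have "rat_pabs p (X m * (Y m - Y n)) \<le> a * rat_pabs p (Y m - Y n)"
      by (simp add: rat_pabs_mult[OF p] mult_right_mono a rat_pabs_nonneg[OF p])
    also have "\<dots> < a * (e / a)" using j mn a by (intro mult_strict_left_mono) auto
    finally have 1: "rat_pabs p (X m * (Y m - Y n)) < e" using a by simp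
    have "rat_pabs p ((X m - X n) * Y n) \<le> rat_pabs p (X m - X n) * b"
      by (simp add: rat_pabs_mult[OF p] mult_left_mono b rat_pabs_nonneg[OF p])
    also have "\<dots> < e / b * b" using i mn b by (intro mult_strict_right_mono) auto
    finally have 2: "rat_pabs p ((X m - X n) * Y n) < e" using b by simp
    show ?thesis
      using rat_pabs_add_max[OF p, of "X m * (Y m - Y n)" "(X m - X n) * Y n"] 1 2
      by (simp add: mult_diff_mult)
  qed
  then show "\<exists>k. \<forall>m\<ge>k. \<forall>n\<ge>k. rat_pabs p (X m * Y m - X n * Y n) < e" by blast
qed

lemma pcauchy_not_pvanishes:
  assumes p: "prime p" and X: "pcauchy p X" and nz: "\<not> pvanishes p X"
  obtains b k where "b > 0" "\<And>n. n \<ge> k \<Longrightarrow> b < rat_pabs p (X n)"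
proof -
  obtain L where L: "(\<lambda>n. rat_pabs p (X n)) \<longlonglongrightarrow> L"
    using pcauchy_abs_convergent[OF p X] by (auto simp: convergent_def)
  have "L \<ge> 0" using L rat_pabs_nonneg[OF p] by (intro LIMSEQ_le_const[OF L]) auto
  moreover have "L \<noteq> 0" using nz L by (auto simp: pvanishes_def)
  ultimately have "L > 0" by simp
  then have "\<forall>\<^sub>F n in sequentially. L / 2 < rat_pabs p (X n)"
    by (intro order_tendstoD(1)[OF L]) auto
  then obtain k where "\<forall>n\<ge>k. L / 2 < rat_pabs p (X n)" by (auto simp: eventually_sequentially)
  then show thesis using that[of "L / 2" k] \<open>L > 0\<close> by simp
qed

lemma pcauchy_inverse:
  assumes p: "prime p" and X: "pcauchy p X" and nz: "\<not> pvanishes p X"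
  shows "pcauchy p (\<lambda>n. inverse (X n))"
  unfolding pcauchy_def
proof (intro allI impI)
  fix e :: real assume e: "e > 0"
  obtain b k where b: "b > 0" "\<And>n. n \<ge> k \<Longrightarrow> b < rat_pabs p (X n)"
    using pcauchy_not_pvanishes[OF p X nz] by blast
  obtain i where i: "\<forall>m\<ge>i. \<forall>n\<ge>i. rat_pabs p (X m - X n) < e * b * b"
    using pcauchyD[OF X, of "e * b * b"] e b by auto
  have "rat_pabs p (inverse (X m) - inverse (X n)) < e" if mn: "m \<ge> max i k" "n \<ge> max i k" for m n
  proof -
    let ?x = "rat_pabs p (X m)" and ?y = "rat_pabs p (X n)"
    have xy: "b < ?x" "b < ?y" using b mn by auto
    then have nz: "X m \<noteq> 0" "X n \<noteq> 0" using b by auto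
    have "rat_pabs p (inverse (X m) - inverse (X n)) = inverse ?x * rat_pabs p (X m - X n) * inverse ?y"
      by (simp add: inverse_diff_inverse nz rat_pabs_minus[OF p] rat_pabs_mult[OF p] rat_pabs_inverse[OF p])
    also have "\<dots> = rat_pabs p (X m - X n) / (?x * ?y)" by (simp add: field_simps)
    also have "\<dots> \<le> rat_pabs p (X m - X n) / (b * b)"
      using xy b by (intro divide_left_mono mult_mono mult_pos_pos rat_pabs_nonneg[OF p]) auto
    also have "\<dots> < e" using i mn b by (simp add: field_simps)
    finally show ?thesis .
  qed
  then show "\<exists>k. \<forall>m\<ge>k. \<forall>n\<ge>k. rat_pabs p (inverse (X m) - inverse (X n)) < e" by blast
qed

lemma pvanishes_diff_inverse:
  assumes p: "prime p" and X: "pcauchy p X" "\<not> pvanishes p X" and Y: "pcauchy p Y" "\<not> pvanishes p Y"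
    and XY: "pvanishes p (\<lambda>n. X n - Y n)"
  shows "pvanishes p (\<lambda>n. inverse (X n) - inverse (Y n))"
proof -
  obtain a i where a: "a > 0" "\<And>n. n \<ge> i \<Longrightarrow> a < rat_pabs p (X n)"
    using pcauchy_not_pvanishes[OF p X] by blast
  obtain b j where b: "b > 0" "\<And>n. n \<ge> j \<Longrightarrow> b < rat_pabs p (Y n)"
    using pcauchy_not_pvanishes[OF p Y] by blast
  have v: "pvanishes p (\<lambda>n. inverse (X n) * (inverse (Y n) * (X n - Y n)))"
    using p X Y XY by (intro pvanishes_mult pcauchy_inverse)
  have "rat_pabs p (inverse (X n) * (inverse (Y n) * (X n - Y n))) = rat_pabs p (inverse (X n) - inverse (Y n))"
    if "n \<ge> max i j" for n
  proof -
    have "X n \<noteq> 0" "Y n \<noteq> 0" using a(2)[of n] b(2)[of n] a(1) b(1) that by auto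
    then have "inverse (X n) - inverse (Y n) = - (inverse (X n) * (inverse (Y n) * (X n - Y n)))"
      by (simp add: field_simps)
    then show ?thesis by (simp add: rat_pabs_minus[OF p])
  qed
  then have "\<forall>\<^sub>F n in sequentially. rat_pabs p (inverse (X n) * (inverse (Y n) * (X n - Y n)))
      = rat_pabs p (inverse (X n) - inverse (Y n))"
    unfolding eventually_sequentially by blast
  from Lim_transform_eventually[OF v[unfolded pvanishes_def] this]
  show ?thesis unfolding pvanishes_def .
qed


section \<open>The field of \<open>p\<close>-adic numbers\<close>

text \<open>
  The prime \<open>p\<close> is the cardinality of the index type, so that each \<open>\<rat>\<^sub>p\<close> is a type of its own and
  an instance of the algebraic and topological type classes. \<open>\<rat>\<^sub>p\<close> is the completion of \<open>\<rat>\<close>: the ring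
  of \<open>p\<close>-adic Cauchy sequences modulo the null sequences.
\<close>

class prime_index = finite +
  assumes prime_CARD: "prime CARD('a)"

typedef 'p padic_seq = "{X. pcauchy CARD('p::prime_index) X}"
  by (auto intro: pcauchy_const)

setup_lifting type_definition_padic_seq

instantiation padic_seq :: (prime_index) comm_ring_1
begin

lift_definition zero_padic_seq :: "'a padic_seq" is "\<lambda>_. 0" by (rule pcauchy_const)
lift_definition one_padic_seq :: "'a padic_seq" is "\<lambda>_. 1" by (rule pcauchy_const)
lift_definition plus_padic_seq :: "'a padic_seq \<Rightarrow> 'a padic_seq \<Rightarrow> 'a padic_seq"
  is "\<lambda>X Y n. X n + Y n" by (rule pcauchy_add[OF prime_CARD])
lift_definition uminus_padic_seq :: "'a padic_seq \<Rightarrow> 'a padic_seq"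
  is "\<lambda>X n. - X n" by (rule pcauchy_minus[OF prime_CARD])
lift_definition minus_padic_seq :: "'a padic_seq \<Rightarrow> 'a padic_seq \<Rightarrow> 'a padic_seq"
  is "\<lambda>X Y n. X n - Y n"
  using pcauchy_add[OF prime_CARD _ pcauchy_minus[OF prime_CARD]] by simp
lift_definition times_padic_seq :: "'a padic_seq \<Rightarrow> 'a padic_seq \<Rightarrow> 'a padic_seq"
  is "\<lambda>X Y n. X n * Y n" by (rule pcauchy_mult[OF prime_CARD])

instance
  by standard (transfer; simp add: algebra_simps fun_eq_iff)+

end

lift_definition padic_null :: "'p::prime_index padic_seq \<Rightarrow> bool" is "pvanishes CARD('p)" .

lift_definition padic_seq_inverse :: "'p::prime_index padic_seq \<Rightarrow> 'p padic_seq"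
  is "\<lambda>X. if pvanishes CARD('p) X then (\<lambda>_. 0) else (\<lambda>n. inverse (X n))"
  using pcauchy_const pcauchy_inverse[OF prime_CARD] by auto

lift_definition padic_seq_norm :: "'p::prime_index padic_seq \<Rightarrow> real"
  is "\<lambda>X. lim (\<lambda>n. rat_pabs CARD('p) (X n))" .

lemma padic_null_0: "padic_null 0"
  by transfer (simp add: pvanishes_const prime_CARD)

lemma padic_null_1: "\<not> padic_null 1"
  by transfer (simp add: pvanishes_const prime_CARD)

lemma padic_null_minus: "padic_null X \<Longrightarrow> padic_null (- X)"
  by transfer (simp add: pvanishes_minus prime_CARD)

lemma padic_null_add: "padic_null X \<Longrightarrow> padic_null Y \<Longrightarrow> padic_null (X + Y)"
  by transfer (simp add: pvanishes_add prime_CARD)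

lemma padic_null_diff: "padic_null X \<Longrightarrow> padic_null Y \<Longrightarrow> padic_null (X - Y)"
  by transfer (simp add: pvanishes_diff prime_CARD)

lemma padic_null_mult: "padic_null Y \<Longrightarrow> padic_null (X * Y)"
  by transfer (simp add: pvanishes_mult prime_CARD)

lemma padic_null_seq_inverse:
  "padic_null (X - Y) \<Longrightarrow> padic_null (padic_seq_inverse X - padic_seq_inverse Y)"
proof transfer
  fix X Y :: "nat \<Rightarrow> rat"
  assume X: "pcauchy CARD('a) X" and Y: "pcauchy CARD('a) Y"
    and XY: "pvanishes CARD('a) (\<lambda>n. X n - Y n)"
  have "pvanishes CARD('a) X \<longleftrightarrow> pvanishes CARD('a) Y"
    using pvanishes_diff[OF prime_CARD, of X, OF _ XY] pvanishes_add[OF prime_CARD XY, of Y]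
    by (simp add: iff_conv_conj_imp)
  then show "pvanishes CARD('a) (\<lambda>n. (if pvanishes CARD('a) X then \<lambda>_. 0 else (\<lambda>n. inverse (X n))) n
      - (if pvanishes CARD('a) Y then \<lambda>_. 0 else (\<lambda>n. inverse (Y n))) n)"
    using pvanishes_diff_inverse[OF prime_CARD X _ Y _ XY] by (auto simp: pvanishes_const prime_CARD)
qed

lemma padic_null_inverse_mult:
  "\<not> padic_null X \<Longrightarrow> padic_null (padic_seq_inverse X * X - 1)"
proof transfer
  fix X :: "nat \<Rightarrow> rat"
  assume X: "pcauchy CARD('a) X" "\<not> pvanishes CARD('a) X"
  obtain b k where b: "b > 0" "\<And>n. n \<ge> k \<Longrightarrow> b < rat_pabs CARD('a) (X n)"
    using pcauchy_not_pvanishes[OF prime_CARD X] by blast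
  have "rat_pabs CARD('a) (inverse (X n) * X n - 1) = 0" if "n \<ge> k" for n
    using b(1) b(2)[OF that] by (cases "X n = 0") auto
  then have "\<forall>\<^sub>F n in sequentially. rat_pabs CARD('a) (inverse (X n) * X n - 1) = 0"
    unfolding eventually_sequentially by blast
  then show "pvanishes CARD('a) (\<lambda>n. (if pvanishes CARD('a) X then \<lambda>_. 0 else (\<lambda>n. inverse (X n))) n * X n - 1)"
    using X(2) by (simp add: pvanishes_def tendsto_eventually)
qed

lemma padic_seq_norm_LIMSEQ:
  fixes X :: "'p::prime_index padic_seq"
  shows "(\<lambda>n. rat_pabs CARD('p) (Rep_padic_seq X n)) \<longlonglongrightarrow> padic_seq_norm X"
  using pcauchy_abs_convergent[OF prime_CARD, of "Rep_padic_seq X"] Rep_padic_seq[of X]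
  by (simp add: padic_seq_norm.rep_eq convergent_LIMSEQ_iff)

lemma padic_seq_norm_nonneg: "0 \<le> padic_seq_norm X"
  by (rule LIMSEQ_le_const[OF padic_seq_norm_LIMSEQ]) (auto intro: rat_pabs_nonneg prime_CARD)

lemma padic_seq_norm_eq_0: "padic_seq_norm X = 0 \<longleftrightarrow> padic_null X"
  unfolding padic_null.rep_eq pvanishes_def
  using padic_seq_norm_LIMSEQ[of X] LIMSEQ_unique by auto

lemma padic_seq_norm_add:
  "padic_seq_norm (X + Y) \<le> max (padic_seq_norm X) (padic_seq_norm Y)"
  by (rule LIMSEQ_le[OF padic_seq_norm_LIMSEQ
        tendsto_max[OF padic_seq_norm_LIMSEQ padic_seq_norm_LIMSEQ]])
    (auto simp: plus_padic_seq.rep_eq intro: rat_pabs_add_max prime_CARD)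

lemma padic_seq_norm_mult: "padic_seq_norm (X * Y) = padic_seq_norm X * padic_seq_norm Y"
  by (rule LIMSEQ_unique[OF padic_seq_norm_LIMSEQ])
    (use tendsto_mult[OF padic_seq_norm_LIMSEQ[of X] padic_seq_norm_LIMSEQ[of Y]]
      in \<open>simp add: times_padic_seq.rep_eq rat_pabs_mult prime_CARD\<close>)

lemma padic_seq_norm_minus: "padic_seq_norm (- X) = padic_seq_norm X"
  by transfer (simp add: rat_pabs_minus prime_CARD)

lemma padic_seq_norm_cong:
  assumes "padic_null (X - Y)"
  shows "padic_seq_norm X = padic_seq_norm Y"
  using padic_seq_norm_add[of "X - Y" Y] padic_seq_norm_add[of "Y - X" X] assms
    padic_seq_norm_eq_0[of "X - Y"] padic_seq_norm_minus[of "X - Y"]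
    padic_seq_norm_nonneg[of X] padic_seq_norm_nonneg[of Y] by simp

quotient_type (overloaded) 'p padic =
  "'p::prime_index padic_seq" / "\<lambda>X Y. padic_null (X - Y)"
proof (rule equivpI)
  show "reflp (\<lambda>X Y::'p padic_seq. padic_null (X - Y))"
    by (simp add: reflp_def padic_null_0)
  show "symp (\<lambda>X Y::'p padic_seq. padic_null (X - Y))"
    using padic_null_minus by (fastforce simp: symp_def)
  show "transp (\<lambda>X Y::'p padic_seq. padic_null (X - Y))"
    using padic_null_add by (fastforce simp: transp_def)
qed

instantiation padic :: (prime_index) field
begin

lift_definition zero_padic :: "'a padic" is 0 .
lift_definition one_padic :: "'a padic" is 1 .
lift_definition plus_padic :: "'a padic \<Rightarrow> 'a padic \<Rightarrow> 'a padic" is "(+)"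
  by (metis add_diff_add padic_null_add)
lift_definition uminus_padic :: "'a padic \<Rightarrow> 'a padic" is uminus
  by (metis minus_diff_minus padic_null_minus)
lift_definition minus_padic :: "'a padic \<Rightarrow> 'a padic \<Rightarrow> 'a padic" is "(-)"
proof -
  fix X X' Y Y' :: "'a padic_seq"
  assume "padic_null (X - X')" "padic_null (Y - Y')"
  then show "padic_null (X - Y - (X' - Y'))"
    using padic_null_diff[of "X - X'" "Y - Y'"] by (simp add: algebra_simps)
qed
lift_definition times_padic :: "'a padic \<Rightarrow> 'a padic \<Rightarrow> 'a padic" is "(*)"
proof -
  fix X X' Y Y' :: "'a padic_seq"
  assume "padic_null (X - X')" "padic_null (Y - Y')"
  then show "padic_null (X * Y - X' * Y')"
    using padic_null_add[OF padic_null_mult[of "Y - Y'" X] padic_null_mult[of "X - X'" Y']]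
    by (simp add: mult_diff_mult mult.commute)
qed
lift_definition inverse_padic :: "'a padic \<Rightarrow> 'a padic" is padic_seq_inverse
  by (rule padic_null_seq_inverse)

definition divide_padic :: "'a padic \<Rightarrow> 'a padic \<Rightarrow> 'a padic" where
  "divide_padic x y = x * inverse y"

instance
proof
  fix a b c :: "'a padic"
  show "(a * b) * c = a * (b * c)" by transfer (simp add: mult.assoc padic_null_0)
  show "a * b = b * a" by transfer (simp add: mult.commute padic_null_0)
  show "1 * a = a" by transfer (simp add: padic_null_0)
  show "(a + b) + c = a + (b + c)" by transfer (simp add: add.assoc padic_null_0)
  show "a + b = b + a" by transfer (simp add: add.commute padic_null_0)
  show "0 + a = a" by transfer (simp add: padic_null_0)
  show "- a + a = 0" by transfer (simp add: padic_null_0)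
  show "a - b = a + - b" by transfer (simp add: padic_null_0)
  show "(a + b) * c = a * c + b * c" by transfer (simp add: algebra_simps padic_null_0)
  show "(0::'a padic) \<noteq> 1"
    by transfer (use padic_null_minus[of "- 1"] padic_null_1 in auto)
  show "a \<noteq> 0 \<Longrightarrow> inverse a * a = 1"
    by transfer (simp add: padic_null_inverse_mult)
  show "a div b = a * inverse b" by (rule divide_padic_def)
  show "inverse (0::'a padic) = 0"
  proof transfer
    have "padic_seq_inverse (0::'a padic_seq) = 0"
      by transfer (simp add: pvanishes_const prime_CARD)
    then show "padic_null (padic_seq_inverse (0::'a padic_seq) - 0)" by (simp add: padic_null_0)
  qed
qed

end

lift_definition padic_norm :: "'p::prime_index padic \<Rightarrow> real" is padic_seq_norm
  by (rule padic_seq_norm_cong)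

lemma padic_norm_nonneg: "0 \<le> padic_norm x"
  by transfer (rule padic_seq_norm_nonneg)

lemma padic_norm_eq_0 [simp]: "padic_norm x = 0 \<longleftrightarrow> x = 0"
  by transfer (simp add: padic_seq_norm_eq_0)

lemma padic_norm_add: "padic_norm (x + y) \<le> max (padic_norm x) (padic_norm y)"
  by transfer (rule padic_seq_norm_add)

lemma padic_norm_mult: "padic_norm (x * y) = padic_norm x * padic_norm y"
  by transfer (rule padic_seq_norm_mult)

lemma padic_norm_minus: "padic_norm (- x) = padic_norm x"
  by transfer (rule padic_seq_norm_minus)

lemma padic_seq_of_nat: "Rep_padic_seq (of_nat k :: 'p::prime_index padic_seq) = (\<lambda>_. of_nat k)"
  by (induction k) (simp_all add: zero_padic_seq.rep_eq one_padic_seq.rep_eq plus_padic_seq.rep_eq)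

lemma abs_padic_of_nat: "abs_padic (of_nat k) = of_nat k"
  by (induction k)
    (simp_all add: zero_padic.abs_eq one_padic.abs_eq plus_padic.abs_eq[symmetric])

lemma padic_norm_of_nat:
  "padic_norm (of_nat k :: 'p::prime_index padic) = rat_pabs CARD('p) (of_nat k)"
  unfolding abs_padic_of_nat[symmetric]
  by (simp add: padic_norm.abs_eq padic_seq_norm.rep_eq padic_seq_of_nat)

instance padic :: (prime_index) field_char_0
proof
  have "m = n" if "(of_nat m :: 'a padic) = of_nat n" "m \<le> n" for m n
  proof -
    have "(of_nat (n - m) :: 'a padic) = 0" using that by (simp add: of_nat_diff)
    then have "rat_pabs CARD('a) (of_nat (n - m)) = 0"
      using padic_norm_of_nat[where ?'p='a, of "n - m"] padic_norm_eq_0[of "0 :: 'a padic"] by metis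
    then have "(of_nat (n - m) :: rat) = 0" by (simp add: rat_pabs_eq_0 prime_CARD)
    then show "m = n" using that by simp
  qed
  then show "inj (of_nat :: nat \<Rightarrow> 'a padic)"
    by (intro injI) (metis nat_le_linear)
qed

lemma padic_norm_of_rat:
  "padic_norm (of_rat r :: 'p::prime_index padic) = rat_pabs CARD('p) r"
proof -
  have i: "padic_norm (of_int a :: 'p padic) = rat_pabs CARD('p) (of_int a)" for a
    using padic_norm_of_nat[where ?'p='p, of "nat \<bar>a\<bar>"]
    by (cases "a \<ge> 0") (simp_all add: padic_norm_minus rat_pabs_minus prime_CARD)
  obtain a b where r: "r = of_int a / of_int b" and b: "b \<noteq> 0" by (rule rat_as_int_quotient)
  have "padic_norm (of_rat r :: 'p padic) * padic_norm (of_int b :: 'p padic) = padic_norm (of_int a :: 'p padic)"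
    unfolding padic_norm_mult[symmetric] using b by (simp add: r of_rat_divide)
  moreover have "rat_pabs CARD('p) r * rat_pabs CARD('p) (of_int b) = rat_pabs CARD('p) (of_int a)"
    unfolding rat_pabs_mult[OF prime_CARD, symmetric] using b by (simp add: r)
  ultimately show ?thesis
    using b by (simp add: i) (metis mult_right_cancel of_int_eq_0_iff prime_CARD rat_pabs_eq_0)
qed

instantiation padic :: (prime_index) metric_space
begin

definition dist_padic :: "'a padic \<Rightarrow> 'a padic \<Rightarrow> real" where
  "dist_padic x y = padic_norm (x - y)"

definition uniformity_padic :: "('a padic \<times> 'a padic) filter" where
  "uniformity_padic = (INF e\<in>{0<..}. principal {(x, y). dist x y < e})"

definition open_padic :: "'a padic set \<Rightarrow> bool" where
  "open_padic U \<longleftrightarrow> (\<forall>x\<in>U. \<forall>\<^sub>F (x', y) in uniformity. x' = x \<longrightarrow> y \<in> U)"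

instance
proof
  fix x y z :: "'a padic"
  show "dist x y = 0 \<longleftrightarrow> x = y" by (simp add: dist_padic_def)
  show "dist x y \<le> dist x z + dist y z"
    using padic_norm_add[of "x - z" "z - y"] padic_norm_minus[of "y - z"]
      padic_norm_nonneg[of "x - z"] padic_norm_nonneg[of "z - y"]
    by (simp add: dist_padic_def)
qed (simp_all add: uniformity_padic_def open_padic_def)

end


section \<open>Digits\<close>

text \<open>
  The digits of \<open>\<beta>\<close> are the \<open>c n < p\<close>, \<open>n \<in> \<int>\<close>, with \<open>\<beta> = \<Sum>\<^sub>n c n * p ^ n\<close> in the \<open>p\<close>-adic topology.
  All digits of \<open>0\<close> are \<open>0\<close>.
\<close>

definition padic_digits :: "'p::prime_index padic \<Rightarrow> int \<Rightarrow> nat" where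
  "padic_digits \<beta> = (THE c. (\<forall>n. c n < CARD('p)) \<and> (\<exists>N. \<forall>n<N. c n = 0) \<and>
      ((\<lambda>n. of_nat (c n) * of_nat CARD('p) powi n) has_sum \<beta>) UNIV)"

text \<open>
  \<open>padic_ord\<close> is the order with \<open>padic_ord 0 = \<infinity>\<close>. The integer \<open>padic_val \<beta>\<close>, needed as an exponent,
  is only meaningful for \<open>\<beta> \<noteq> 0\<close>.
\<close>

definition padic_val :: "'p::prime_index padic \<Rightarrow> int" where
  "padic_val \<beta> = (LEAST n. padic_digits \<beta> n \<noteq> 0)"

definition padic_ord :: "'p::prime_index padic \<Rightarrow> int extended" where
  "padic_ord \<beta> = (if \<beta> = 0 then \<infinity> else Fin (padic_val \<beta>))"

definition padic_omega :: "'p::prime_index padic \<Rightarrow> nat" where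
  "padic_omega \<beta> = padic_digits \<beta> 0"

definition padic_frac :: "'p::prime_index padic \<Rightarrow> 'p padic" where
  "padic_frac \<beta> = (\<Sum>\<^sub>\<infinity>n\<in>{1..}. of_nat (padic_digits \<beta> n) * of_nat CARD('p) powi n)"

definition padic_integers :: "'p::prime_index padic set" where
  "padic_integers = {\<beta>. 0 \<le> padic_ord \<beta>}"


section \<open>Subfields, degrees and minimal polynomials\<close>

definition is_subfield :: "'a::field set \<Rightarrow> bool" where
  "is_subfield K \<longleftrightarrow> 0 \<in> K \<and> 1 \<in> K \<and> (\<forall>x\<in>K. \<forall>y\<in>K. x + y \<in> K \<and> x * y \<in> K) \<and>
    (\<forall>x\<in>K. - x \<in> K \<and> inverse x \<in> K)"

text \<open>The degree \<open>[K : \<rat>]\<close> of a subfield \<open>K\<close> is \<open>rat_dim K\<close>. Note that \<open>dim\<close> is \<open>0\<close> for infinite-dimensional spaces.\<close>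

global_interpretation rat_vs: vector_space "\<lambda>(q::rat) (x::'a::field_char_0). of_rat q * x"
  defines rat_dim = rat_vs.dim
  by standard (simp_all add: algebra_simps of_rat_add of_rat_mult)

definition rat_adjoin :: "'a::field_char_0 \<Rightarrow> 'a set" where
  "rat_adjoin z = is_subfield hull (insert z \<rat>)"

definition min_poly :: "'a::field_char_0 \<Rightarrow> rat poly" where
  "min_poly \<beta> = (THE f. lead_coeff f = 1 \<and> poly (map_poly of_rat f) \<beta> = 0 \<and>
     (\<forall>g. g \<noteq> 0 \<and> poly (map_poly of_rat g) \<beta> = 0 \<longrightarrow> degree f \<le> degree g))"

text \<open>
  In terms of the minimal polynomial \<open>x ^ n + a\<^sub>1 * x ^ (n - 1) + ... + a\<^sub>n\<close>, the coefficients of index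
  \<open>1\<close> and \<open>0\<close> are \<open>a\<^bsub>n-1\<^esub>\<close> and \<open>a\<^sub>n\<close>.
\<close>

definition condition_H :: "'p::prime_index padic \<Rightarrow> bool" where
  "condition_H \<beta> \<longleftrightarrow> algebraic \<beta> \<and> \<beta> \<notin> \<rat> \<and> \<beta> \<in> (\<lambda>x. of_nat CARD('p) * x) ` padic_integers \<and>
     (\<forall>i. (of_rat (coeff (min_poly \<beta>) i) :: 'p padic) \<in> padic_integers) \<and>
     padic_ord (of_rat (coeff (min_poly \<beta>) 1) :: 'p padic) = 0 \<and>
     padic_ord (of_rat (coeff (min_poly \<beta>) 0) :: 'p padic) > 0"


section \<open>The continued fraction map\<close>

text \<open>
  \<open>rat_coords z g\<close> is the pair of coordinates of \<open>g\<close> in the \<open>\<rat>\<close>-basis \<open>1, z\<close>; it is only meaningful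
  for irrational \<open>z\<close> and \<open>g\<close> in the span of \<open>1, z\<close>. Accordingly, \<open>cf_map \<epsilon> z\<close> is the map \<open>T\<close> on the
  quadratic field \<open>\<rat>(z)\<close> and has no meaning outside of it.
\<close>

definition rat_coords :: "'a::field_char_0 \<Rightarrow> 'a \<Rightarrow> rat \<times> rat" where
  "rat_coords z g = (THE (a0, a1). g = of_rat a0 + of_rat a1 * z)"

definition coprime_part :: "nat \<Rightarrow> rat \<Rightarrow> nat" where
  "coprime_part p r = (if r = 0 then 1
     else (GREATEST d. d > 0 \<and> coprime d p \<and> int d dvd fst (quotient_of r)))"

definition cf_remainder :: "int \<Rightarrow> 'p::prime_index padic \<Rightarrow> 'p padic" where
  "cf_remainder \<epsilon> \<alpha> = (if \<alpha> = 0 then 0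
     else let \<gamma> = of_int \<epsilon> * of_nat CARD('p) powi padic_val \<alpha> / \<alpha> in \<gamma> - of_nat (padic_omega \<gamma>))"

definition cf_map :: "int \<Rightarrow> 'p::prime_index padic \<Rightarrow> 'p padic \<Rightarrow> 'p padic" where
  "cf_map \<epsilon> z \<alpha> = (let g = cf_remainder \<epsilon> \<alpha>; (a0, a1) = rat_coords z g; a' = coprime_part CARD('p) a1
     in g / of_nat a' - padic_frac (of_rat (a0 / of_nat a')))"

end

theory Submission
  imports Defs
begin

text \<open>
  The conjugate of \<open>z\<close> is \<open>z' = - a - z\<close>, a \<open>p\<close>-adic unit, where \<open>z\<^sup>2 + a z + b = 0\<close>. The \<open>z\<close>-coordinate of the
  remainder of \<open>\<alpha> = s + t z\<close> is \<open>q = - \<epsilon> p ^ ord(\<alpha>) t / (\<alpha> \<alpha>')\<close> with \<open>\<alpha>' = s + t z'\<close>. After one step of the map,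
  \<open>\<alpha>\<close> lies in \<open>p \<int>\<^sub>p\<close> and \<open>s\<close> is \<open>0\<close> or has order at most \<open>0\<close>. Hence \<open>|s| = |t z| < |t|\<close> unless \<open>s = 0\<close>, so that \<open>|\<alpha>'| = |t|\<close>
  and \<open>q\<close> is a unit. The rational part of the next iterate is then divisible by \<open>p\<close>, so it vanishes, and dividing
  by the prime-to-\<open>p\<close> part of the numerator leaves \<open>\<plusminus> z / d\<close> with \<open>d\<close> the denominator of \<open>q\<close>. On such elements
  \<open>q = \<plusminus> d p ^ ord(z) / b\<close>, whose denominator is bounded independently of \<open>d\<close>, so the orbit enters a finite set.
  The remainder of a rational number is a rational number in \<open>p \<int>\<^sub>p\<close>, which the map sends to \<open>0\<close>.
\<close>

section \<open>Norms and digits\<close>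

lemma CARD_gt_1: "1 < CARD('p::prime_index)"
  using prime_CARD[where 'a='p] by (rule prime_gt_1_nat)

lemma padic_norm_0 [simp]: "padic_norm 0 = 0"
  by simp

lemma CARD_powi_le_iff [simp]: "real CARD('p::prime_index) powi m \<le> real CARD('p) powi n \<longleftrightarrow> m \<le> n"
  using CARD_gt_1[where ?'p='p] power_int_increasing[of m n "real CARD('p)"]
    power_int_strict_increasing[of n m "real CARD('p)"] by (cases "m \<le> n") simp_all

lemma of_rat_power_int: "(of_rat (x powi n) :: 'a::field_char_0) = of_rat x powi n"
  by (simp add: power_int_def of_rat_power of_rat_inverse)

text \<open>For nonzero k the norm is p to the minus multiplicity of p in k, so it drops below 1
  exactly when that multiplicity is positive.\<close>

lemma padic_norm_of_int_dvd_iff: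
  "padic_norm (of_int k :: 'p::prime_index padic) < 1 \<longleftrightarrow> int CARD('p) dvd k"
proof (cases "k = 0")
  case False
  have pe: "prime_elem (int CARD('p))" using prime_CARD[where 'a='p] by simp
  have "rat_pval CARD('p) (of_int k / of_int 1) = int (multiplicity (int CARD('p)) k)"
    by (subst rat_pval_divide[OF prime_CARD False]) auto
  then have "padic_norm (of_int k :: 'p padic) = real CARD('p) powi (- int (multiplicity (int CARD('p)) k))"
    using padic_norm_of_rat[where ?'p='p, of "of_int k"] False by (simp add: rat_pabs_def)
  moreover have "multiplicity (int CARD('p)) k = 0 \<longleftrightarrow> \<not> int CARD('p) dvd k"
    by (rule multiplicity_eq_zero_iff) (use False pe in auto)
  moreover have "real CARD('p) powi 0 \<le> real CARD('p) powi (- int m) \<longleftrightarrow> m = 0" for m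
    unfolding CARD_powi_le_iff by simp
  ultimately show ?thesis by (metis not_le power_int_0_right)
qed simp

lemma padic_norm_of_int_le: "padic_norm (of_int k :: 'p::prime_index padic) \<le> 1"
proof (induction k rule: int_induct[where k=0])
  case (step1 i)
  have "padic_norm (1 :: 'p padic) = 1"
    using padic_norm_of_rat[where ?'p='p, of 1] by (simp add: rat_pabs_1 prime_CARD)
  then show ?case using padic_norm_add[of "of_int i :: 'p padic" 1] step1 by simp
next
  case (step2 i)
  have "padic_norm (- 1 :: 'p padic) = 1"
    using padic_norm_of_rat[where ?'p='p, of 1] padic_norm_minus[of "1 :: 'p padic"]
    by (simp add: rat_pabs_1 prime_CARD)
  then show ?case using padic_norm_add[of "of_int i :: 'p padic" "- 1"] step2 by simp
qed simp

lemma padic_norm_1 [simp]: "padic_norm (1 :: 'p::prime_index padic) = 1"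
  using padic_norm_of_rat[where ?'p='p, of 1] by (simp add: rat_pabs_1 prime_CARD)

lemma padic_norm_inverse: "padic_norm (inverse x) = inverse (padic_norm x)"
  using padic_norm_mult[of x "inverse x"] by (cases "x = 0") (simp_all add: inverse_unique)

lemma padic_norm_divide: "padic_norm (x / y) = padic_norm x / padic_norm y"
  by (simp add: divide_inverse padic_norm_mult padic_norm_inverse)

lemma padic_norm_power: "padic_norm (x ^ n) = padic_norm x ^ n"
  by (induction n) (simp_all add: padic_norm_mult)

lemma padic_norm_powi: "padic_norm (x powi n) = padic_norm x powi n"
  by (simp add: power_int_def padic_norm_power padic_norm_inverse)

lemma padic_norm_diff_commute: "padic_norm (x - y) = padic_norm (y - x)"
  using padic_norm_minus[of "x - y"] by simp

lemma padic_norm_diff: "padic_norm (x - y) \<le> max (padic_norm x) (padic_norm y)"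
  using padic_norm_add[of x "- y"] by (simp add: padic_norm_minus)

text \<open>The isosceles property of ultrametrics: in y = (x + y) - x the smaller term x cannot
  account for the norm of y.\<close>

lemma padic_norm_add_eq:
  assumes "padic_norm x < padic_norm y"
  shows "padic_norm (x + y) = padic_norm y"
  using padic_norm_add[of x y] padic_norm_diff[of "x + y" x] assms by auto

lemma padic_norm_CARD: "padic_norm (of_nat CARD('p) :: 'p::prime_index padic) = inverse (real CARD('p))"
proof -
  have "rat_pval CARD('p) (of_int (int CARD('p)) / of_int 1) = 1"
    using prime_CARD[where 'a='p] CARD_gt_1[where ?'p='p]
    by (subst rat_pval_divide[OF prime_CARD]) (auto intro: multiplicity_self)
  then show ?thesis by (simp add: padic_norm_of_nat rat_pabs_def power_int_minus)
qed

lemma padic_norm_CARD_powi: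
  "padic_norm (of_nat CARD('p) powi n :: 'p::prime_index padic) = real CARD('p) powi (- n)"
  by (simp add: padic_norm_powi padic_norm_CARD power_int_inverse power_int_minus)

text \<open>Norms of nonzero rationals are integral powers of p, so none lies strictly between 1 / p
  and 1.\<close>

lemma padic_norm_of_rat_less_1:
  assumes "padic_norm (of_rat r :: 'p::prime_index padic) < 1"
  shows "padic_norm (of_rat r :: 'p padic) \<le> real CARD('p) powi (- 1)"
proof (cases "r = 0")
  case False
  have e: "padic_norm (of_rat r :: 'p padic) = real CARD('p) powi (- rat_pval CARD('p) r)"
    using False by (simp add: padic_norm_of_rat rat_pabs_def)
  have "\<not> real CARD('p) powi 0 \<le> real CARD('p) powi (- rat_pval CARD('p) r)"
    using assms unfolding e by simp
  then have "- rat_pval CARD('p) r \<le> - 1" unfolding CARD_powi_le_iff by simp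
  then show ?thesis unfolding e CARD_powi_le_iff .
qed simp

lemma padic_norm_sum_le:
  assumes "\<And>i. i \<in> A \<Longrightarrow> padic_norm (f i) \<le> B" and "0 \<le> B"
  shows "padic_norm (sum f A) \<le> B"
  using assms(1)
proof (induction A rule: infinite_finite_induct)
  case (insert x A)
  then have "padic_norm (f x) \<le> B" "padic_norm (sum f A) \<le> B" by auto
  then show ?case using insert.hyps padic_norm_add[of "f x" "sum f A"] by simp
qed (use assms in auto)

section \<open>Rational approximation and residues modulo p\<close>

lemma padic_rat_dense:
  fixes \<beta> :: "'p::prime_index padic"
  assumes "0 < e"
  obtains r where "padic_norm (\<beta> - of_rat r) \<le> e"
proof -
  \<comment> \<open>A late term of a representing Cauchy sequence, taken as a constant sequence, is
    the approximation; the norm of the difference is a limit of distances below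
    \<open>e\<close>.\<close>
  obtain X where X: "\<beta> = abs_padic X" by (metis Quotient_abs_rep Quotient_padic)
  have "pcauchy CARD('p) (Rep_padic_seq X)" using Rep_padic_seq[of X] by simp
  then obtain k where k: "\<forall>m\<ge>k. \<forall>n\<ge>k. rat_pabs CARD('p) (Rep_padic_seq X m - Rep_padic_seq X n) < e"
    using pcauchyD[OF _ assms] by blast
  define r where "r = Rep_padic_seq X k"
  define Y :: "'p padic_seq" where "Y = Abs_padic_seq (\<lambda>_. r)"
  have Y: "Rep_padic_seq Y = (\<lambda>_. r)" unfolding Y_def by (simp add: Abs_padic_seq_inverse pcauchy_const)
  \<comment> \<open>Sequences form only a ring, so the constant sequence of r = a / b is identified
    by multiplying with b before passing to the quotient.\<close>
  have "abs_padic Y = of_rat r"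
  proof -
    obtain a b where r: "r = of_int a / of_int b" and b: "b \<noteq> 0" by (rule rat_as_int_quotient)
    have int: "Rep_padic_seq (of_int i :: 'p padic_seq) = (\<lambda>_. of_int i)" for i
      by (cases i rule: int_cases2)
        (simp_all add: padic_seq_of_nat uminus_padic_seq.rep_eq)
    have absint: "abs_padic (of_int i :: 'p padic_seq) = of_int i" for i
      by (cases i rule: int_cases2)
        (simp_all add: abs_padic_of_nat uminus_padic.abs_eq[symmetric])
    have "Y * of_int b = of_int a"
      using b by (intro Rep_padic_seq_inject[THEN iffD1]) (simp add: times_padic_seq.rep_eq Y int r)
    then have "abs_padic Y * of_int b = of_int a"
      by (metis absint times_padic.abs_eq)
    then show ?thesis using b by (simp add: r of_rat_divide field_simps)
  qed
  then have "padic_norm (\<beta> - of_rat r) = padic_seq_norm (X - Y)"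
    by (metis X minus_padic.abs_eq padic_norm.abs_eq)
  also have "\<dots> \<le> e"
  proof (rule LIMSEQ_le_const2[OF padic_seq_norm_LIMSEQ])
    show "\<exists>N. \<forall>n\<ge>N. rat_pabs CARD('p) (Rep_padic_seq (X - Y) n) \<le> e"
      using k by (auto simp: minus_padic_seq.rep_eq Y r_def intro!: exI[of _ k] less_imp_le)
  qed
  finally show thesis by (rule that)
qed

text \<open>The residue field is that of the integers modulo p: a rational n / d close to
  \<open>\<beta>\<close> has d prime to p, and n times an inverse of d modulo p gives the
  residue.\<close>

lemma padic_residue_exists:
  fixes \<beta> :: "'p::prime_index padic"
  assumes "padic_norm \<beta> \<le> 1"
  shows "\<exists>c<CARD('p). padic_norm (\<beta> - of_nat c) \<le> inverse (real CARD('p))"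
proof -
  have p: "0 < inverse (real CARD('p))" "inverse (real CARD('p)) < 1"
    using CARD_gt_1[where ?'p='p] by (auto simp: field_simps)
  obtain r where r: "padic_norm (\<beta> - of_rat r) \<le> inverse (real CARD('p))"
    using padic_rat_dense[OF p(1)] by blast
  then have r1: "padic_norm (of_rat r :: 'p padic) \<le> 1"
    using padic_norm_diff[of \<beta> "\<beta> - of_rat r"] assms p by auto
  obtain n d where q: "quotient_of r = (n, d)" by (cases "quotient_of r")
  have d: "d > 0" and re: "r = of_int n / of_int d" and cop: "coprime n d"
    using quotient_of_denom_pos[OF q] quotient_of_div[OF q] quotient_of_coprime[OF q] by auto
  have nd: "padic_norm (of_int n :: 'p padic) \<le> padic_norm (of_int d :: 'p padic)"
    using r1 d padic_norm_nonneg[of "of_int d :: 'p padic"]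
    by (auto simp add: re of_rat_divide padic_norm_divide divide_le_eq split: if_splits)
  have pp: "prime (int CARD('p))" using prime_CARD[where 'a='p] by simp
  have pd: "\<not> int CARD('p) dvd d"
  proof
    assume "int CARD('p) dvd d"
    moreover from this have "int CARD('p) dvd n"
      using nd padic_norm_of_int_dvd_iff[where ?'p='p] by (metis order_le_less_trans)
    ultimately have "is_unit (int CARD('p))" using cop coprime_common_divisor by blast
    then show False using pp by (simp add: not_prime_unit)
  qed
  then have d1: "padic_norm (of_int d :: 'p padic) = 1"
    using padic_norm_of_int_dvd_iff[where ?'p='p, of d] padic_norm_of_int_le[where ?'p='p, of d] by simp
  have "coprime d (int CARD('p))" using pd pp by (metis coprime_commute prime_imp_coprime)
  then obtain x v where x: "x * d + v * int CARD('p) = 1" using bezout_int[of d "int CARD('p)"] by auto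
  \<comment> \<open>The Bezout coefficient x inverts d modulo p, so c is congruent to n / d.\<close>
  define c where "c = (n * x) mod int CARD('p)"
  have c: "0 \<le> c" "c < int CARD('p)" using CARD_gt_1[where ?'p='p] by (auto simp: c_def)
  have "c = n * x - int CARD('p) * (n * x div int CARD('p))" unfolding c_def by (simp add: minus_mult_div_eq_mod)
  then have "n - d * c = n * (x * d + v * int CARD('p)) - d * (n * x - int CARD('p) * (n * x div int CARD('p)))"
    unfolding x by simp
  also have "\<dots> = int CARD('p) * (n * v + d * (n * x div int CARD('p)))" by (simp add: algebra_simps)
  finally have "int CARD('p) dvd n - d * c" by simp
  then have "padic_norm (of_int (n - d * c) :: 'p padic) < 1" by (simp only: padic_norm_of_int_dvd_iff)
  moreover have "of_int (n - d * c) = of_rat (r - of_int c) * (of_int d :: 'p padic)"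
    using d by (simp add: re of_rat_diff of_rat_divide left_diff_distrib)
  ultimately have "padic_norm (of_rat (r - of_int c) :: 'p padic) < 1" by (simp add: padic_norm_mult d1)
  \<comment> \<open>Discreteness of the norm on rationals sharpens the bound from below 1 to at most
    1 / p.\<close>
  from padic_norm_of_rat_less_1[OF this]
  have "padic_norm (of_rat r - of_nat (nat c) :: 'p padic) \<le> inverse (real CARD('p))"
    using c by (simp add: of_rat_diff power_int_minus)
  then have "padic_norm (\<beta> - of_nat (nat c)) \<le> inverse (real CARD('p))"
    using r padic_norm_add[of "\<beta> - of_rat r" "of_rat r - of_nat (nat c)"] by simp
  moreover have "nat c < CARD('p)" using c by simp
  ultimately show ?thesis by blast
qed

section \<open>Existence and uniqueness of digit expansions\<close>

definition digit_sum :: "(int \<Rightarrow> nat) \<Rightarrow> int \<Rightarrow> int \<Rightarrow> 'p::prime_index padic" where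
  "digit_sum c N M = (\<Sum>n\<in>{N..<M}. of_nat (c n) * of_nat CARD('p) powi n)"

lemma padic_norm_digit_term:
  "padic_norm (of_nat k * of_nat CARD('p) powi n :: 'p::prime_index padic) \<le> real CARD('p) powi (- n)"
  using padic_norm_of_int_le[where ?'p='p, of "int k"]
  by (simp add: padic_norm_mult padic_norm_CARD_powi mult_left_le_one_le padic_norm_nonneg)

text \<open>The digits are integers so that differences of two digit expansions are covered.\<close>

lemma small_digit_sum:
  fixes d :: "int \<Rightarrow> int"
  assumes d: "\<And>n. \<bar>d n\<bar> < int CARD('p)" and le: "N \<le> M"
    and S: "padic_norm (\<Sum>n\<in>{N..<M}. of_int (d n) * of_nat CARD('p) powi n :: 'p::prime_index padic)
      \<le> real CARD('p) powi (- M)"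
    and n: "n \<in> {N..<M}"
  shows "d n = 0"
  using le S n
proof (induction M arbitrary: n rule: int_ge_induct)
  case (step M)
  define S where "S = (\<Sum>n\<in>{N..<M}. of_int (d n) * of_nat CARD('p) powi n :: 'p padic)"
  define t where "t = (of_int (d M) * of_nat CARD('p) powi M :: 'p padic)"
  have "{N..<M + 1} = insert M {N..<M}" using step.hyps by auto
  then have eq: "(\<Sum>n\<in>{N..<M + 1}. of_int (d n) * of_nat CARD('p) powi n :: 'p padic) = t + S"
    by (simp add: S_def t_def)
  have t: "padic_norm t = padic_norm (of_int (d M) :: 'p padic) * real CARD('p) powi (- M)"
    by (simp add: t_def padic_norm_mult padic_norm_CARD_powi)
  have tM: "padic_norm t \<le> real CARD('p) powi (- M)"
    unfolding t using padic_norm_of_int_le[where ?'p='p, of "d M"]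
    by (simp add: mult_left_le_one_le padic_norm_nonneg)
  have tS: "padic_norm (t + S) \<le> real CARD('p) powi (- (M + 1))" using step.prems(1) unfolding eq .
  also have "\<dots> \<le> real CARD('p) powi (- M)" by simp
  \<comment> \<open>The top term already satisfies this bound, hence so does the lower part of the
    sum, and the induction hypothesis kills its digits.\<close>
  finally have "padic_norm S \<le> real CARD('p) powi (- M)"
    using padic_norm_diff[of "t + S" t] tM by auto
  then have z: "d n = 0" if "n \<in> {N..<M}" for n using step.IH that by (simp add: S_def)
  then have "S = 0" by (simp add: S_def)
  moreover have "real CARD('p) powi (- (M + 1)) = real CARD('p) powi (- 1) * real CARD('p) powi (- M)"
    using CARD_gt_1[where ?'p='p] power_int_add[of "real CARD('p)" "- 1" "- M"]
    by (simp add: algebra_simps)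
  \<comment> \<open>Only the top term is left. Cancelling the power of p shows that p divides
    \<open>d M\<close>, whose absolute value is below p.\<close>
  ultimately have "padic_norm (of_int (d M) :: 'p padic) * real CARD('p) powi (- M)
      \<le> real CARD('p) powi (- 1) * real CARD('p) powi (- M)"
    using tS t by simp
  moreover have "0 < real CARD('p) powi (- M)" using CARD_gt_1[where ?'p='p] by simp
  ultimately have "padic_norm (of_int (d M) :: 'p padic) \<le> real CARD('p) powi (- 1)"
    by (simp only: mult_le_cancel_right)
  also have "\<dots> < 1" using CARD_gt_1[where ?'p='p] by (simp add: power_int_minus field_simps)
  finally have "int CARD('p) dvd d M" by (simp add: padic_norm_of_int_dvd_iff)
  then have "d M = 0" using d[of M] zdvd_not_zless[of "\<bar>d M\<bar>" "int CARD('p)"] by fastforce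
  then show ?case using z step.prems(2) by (cases "n = M") auto
qed simp

text \<open>Explicit truncation errors replace the infinite sum, so that expansions can be compared
  digit by digit.\<close>

definition is_digits :: "(int \<Rightarrow> nat) \<Rightarrow> int \<Rightarrow> 'p::prime_index padic \<Rightarrow> bool" where
  "is_digits c N \<beta> \<longleftrightarrow> (\<forall>n. c n < CARD('p)) \<and> (\<forall>n<N. c n = 0) \<and>
     (\<forall>M\<ge>N. padic_norm (\<beta> - digit_sum c N M) \<le> real CARD('p) powi (- M))"

text \<open>Every term of exponent at least M has norm at most p to the minus M. Hence each finite
  sum containing the truncation before M is that close to it; fact \<open>F\<close> records this for
  both directions.\<close>

lemma has_sum_iff_is_digits:
  fixes \<beta> :: "'p::prime_index padic"
  assumes b: "\<forall>n. c n < CARD('p)" and z: "\<forall>n<N. c n = 0"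
  shows "((\<lambda>n. of_nat (c n) * of_nat CARD('p) powi n) has_sum \<beta>) UNIV \<longleftrightarrow> is_digits c N \<beta>"
    (is "(?f has_sum \<beta>) UNIV \<longleftrightarrow> _")
proof -
  have F: "padic_norm (sum ?f F - digit_sum c N M) \<le> real CARD('p) powi (- M)"
    if "finite F" "{N..<M} \<subseteq> F" for F M
  proof -
    have "sum ?f F - digit_sum c N M = sum ?f (F - {N..<M})"
      using that by (simp add: digit_sum_def sum_diff)
    also have "padic_norm \<dots> \<le> real CARD('p) powi (- M)"
    proof (rule padic_norm_sum_le)
      fix n assume n: "n \<in> F - {N..<M}"
      show "padic_norm (?f n) \<le> real CARD('p) powi (- M)"
      proof (cases "n < N")
        case False
        then have "real CARD('p) powi (- n) \<le> real CARD('p) powi (- M)" using n by simp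
        then show ?thesis using padic_norm_digit_term[where ?'p='p, of "c n" n] by linarith
      qed (use z in simp)
    qed simp
    finally show ?thesis .
  qed
  show ?thesis
  proof
    assume h: "(?f has_sum \<beta>) UNIV"
    show "is_digits c N \<beta>"
      unfolding is_digits_def
    proof (intro conjI b z allI impI)
      fix M assume "N \<le> M"
      have "0 < real CARD('p) powi (- M)" using CARD_gt_1[where ?'p='p] by simp
      then have "\<forall>\<^sub>F F in finite_subsets_at_top UNIV. dist (sum ?f F) \<beta> < real CARD('p) powi (- M)"
        using h unfolding has_sum_def by (rule tendstoD[rotated])
      then obtain X where X: "finite X"
        "\<And>Y. finite Y \<Longrightarrow> X \<subseteq> Y \<Longrightarrow> dist (sum ?f Y) \<beta> < real CARD('p) powi (- M)"
        unfolding eventually_finite_subsets_at_top by auto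
      \<comment> \<open>Adding the truncation range to X makes both estimates apply to the same
        finite sum.\<close>
      define Y where "Y = X \<union> {N..<M}"
      have "padic_norm (\<beta> - sum ?f Y) < real CARD('p) powi (- M)"
        using X(1) X(2)[of Y] by (simp add: Y_def dist_padic_def padic_norm_diff_commute)
      moreover have "padic_norm (sum ?f Y - digit_sum c N M) \<le> real CARD('p) powi (- M)"
        by (rule F) (use X in \<open>auto simp: Y_def\<close>)
      ultimately show "padic_norm (\<beta> - digit_sum c N M) \<le> real CARD('p) powi (- M)"
        using padic_norm_add[of "\<beta> - sum ?f Y" "sum ?f Y - digit_sum c N M"] by simp
    qed
  next
    assume h: "is_digits c N \<beta>"
    show "(?f has_sum \<beta>) UNIV"
      unfolding has_sum_def
    proof (rule tendstoI)
      fix e :: real assume e: "0 < e"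
      obtain k where k: "inverse (real CARD('p)) ^ k < e"
        using real_arch_pow_inv[OF e, of "inverse (real CARD('p))"] CARD_gt_1[where ?'p='p]
        by (auto simp: field_simps)
      define M where "M = max N (int k)"
      have "real CARD('p) powi (- M) \<le> real CARD('p) powi (- int k)" by (simp add: M_def)
      also have "\<dots> < e" using k by (simp add: power_int_minus power_inverse)
      finally have M: "real CARD('p) powi (- M) < e" "N \<le> M" by (simp_all add: M_def)
      show "\<forall>\<^sub>F F in finite_subsets_at_top UNIV. dist (sum ?f F) \<beta> < e"
        unfolding eventually_finite_subsets_at_top
      proof (intro exI[of _ "{N..<M}"] conjI allI impI; (elim conjE)?)
        fix Y assume Y: "finite Y" "{N..<M} \<subseteq> Y"
        have "padic_norm (digit_sum c N M - \<beta>) \<le> real CARD('p) powi (- M)"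
          using h M by (simp add: is_digits_def padic_norm_diff_commute)
        then show "dist (sum ?f Y) \<beta> < e"
          using F[OF Y] M padic_norm_add[of "sum ?f Y - digit_sum c N M" "digit_sum c N M - \<beta>"]
          by (simp add: dist_padic_def)
      qed auto
    qed
  qed
qed

text \<open>Truncations of two expansions of the same number differ by little, and their difference
  has coefficients of absolute value below p, so \<open>small_digit_sum\<close> applies. Cutting at
  n + 1 brings the digit n into the range.\<close>

lemma is_digits_unique:
  fixes \<beta> :: "'p::prime_index padic"
  assumes c: "is_digits c N \<beta>" and c': "is_digits c' N \<beta>"
  shows "c = c'"
proof
  fix n
  show "c n = c' n"
  proof (cases "n < N")
    case False
    define d where "d = (\<lambda>n. int (c n) - int (c' n))"
    define M where "M = n + 1"
    have M: "N \<le> M" "n \<in> {N..<M}" using False by (auto simp: M_def)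
    have e: "(\<Sum>n\<in>{N..<M}. of_int (d n) * of_nat CARD('p) powi n :: 'p padic)
        = digit_sum c N M - digit_sum c' N M"
      by (simp add: digit_sum_def d_def sum_subtractf left_diff_distrib)
    have "padic_norm (\<beta> - digit_sum c' N M - (\<beta> - digit_sum c N M)) \<le> real CARD('p) powi (- M)"
      by (rule order_trans[OF padic_norm_diff]) (use c c' M in \<open>auto simp: is_digits_def\<close>)
    then have "padic_norm (\<Sum>n\<in>{N..<M}. of_int (d n) * of_nat CARD('p) powi n :: 'p padic)
        \<le> real CARD('p) powi (- M)"
      unfolding e by simp
    moreover have "\<bar>d n\<bar> < int CARD('p)" for n
    proof -
      have "c n < CARD('p)" "c' n < CARD('p)" using c c' by (auto simp: is_digits_def)
      then show ?thesis by (simp add: d_def)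
    qed
    ultimately have "d n = 0" using small_digit_sum[of d N M n] M by blast
    then show ?thesis by (simp add: d_def)
  qed (use c c' in \<open>simp add: is_digits_def\<close>)
qed

text \<open>The greedy algorithm: scale into the p-adic integers, then repeatedly subtract a residue
  and divide by p.\<close>

lemma is_digits_exists:
  fixes \<beta> :: "'p::prime_index padic"
  obtains c N where "is_digits c N \<beta>"
proof -
  have "1 < real CARD('p)" using CARD_gt_1[where ?'p='p] by simp
  then obtain k where k: "padic_norm \<beta> < real CARD('p) ^ k" using real_arch_pow by blast
  define N where "N = - int k"
  define P :: "'p padic" where "P = of_nat CARD('p)"
  have P: "P \<noteq> 0" by (simp add: P_def)
  define dg where "dg x = (SOME c. c < CARD('p) \<and> padic_norm (x - of_nat c) \<le> inverse (real CARD('p)))"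
    for x :: "'p padic"
  have dg: "dg x < CARD('p)" "padic_norm (x - of_nat (dg x)) \<le> inverse (real CARD('p))"
    if "padic_norm x \<le> 1" for x
    using someI_ex[OF padic_residue_exists[OF that]] unfolding dg_def by auto
  \<comment> \<open>\<open>b i\<close> is the rescaled remainder after i digits: the i-th truncation
    error is \<open>P powi (N + int i) * b i\<close>.\<close>
  define b where "b = rec_nat (\<beta> / P powi N) (\<lambda>_ x. (x - of_nat (dg x)) / P)"
  have bS: "b (Suc i) = (b i - of_nat (dg (b i))) / P" for i by (simp add: b_def)
  have b1: "padic_norm (b i) \<le> 1" for i
  proof (induction i)
    case 0
    have "padic_norm \<beta> \<le> real CARD('p) powi (- N)" using k by (simp add: N_def)
    then show ?case
      using CARD_gt_1[where ?'p='p]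
      by (simp add: b_def P_def padic_norm_divide padic_norm_CARD_powi divide_le_eq)
  next
    case (Suc i)
    then show ?case
      using dg(2)[OF Suc] CARD_gt_1[where ?'p='p]
      by (simp add: bS P_def padic_norm_divide padic_norm_CARD field_simps)
  qed
  define c where "c = (\<lambda>n. if n < N then 0 else dg (b (nat (n - N))))"
  have S: "\<beta> - digit_sum c N (N + int i) = P powi (N + int i) * b i" for i
  proof (induction i)
    case (Suc i)
    have "{N..<N + int (Suc i)} = insert (N + int i) {N..<N + int i}" by auto
    then have "digit_sum c N (N + int (Suc i)) =
        of_nat (c (N + int i)) * P powi (N + int i) + digit_sum c N (N + int i)"
      by (simp add: digit_sum_def P_def)
    then have "\<beta> - digit_sum c N (N + int (Suc i))
        = P powi (N + int i) * b i - of_nat (c (N + int i)) * P powi (N + int i)"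
      using Suc by (simp add: algebra_simps)
    also have "\<dots> = P powi (N + int i) * (b i - of_nat (dg (b i)))"
      by (simp add: c_def algebra_simps)
    also have "\<dots> = P powi (N + int (Suc i)) * b (Suc i)"
      using P by (simp add: bS power_int_add)
    finally show ?case .
  qed (simp add: digit_sum_def b_def P)
  have "is_digits c N \<beta>"
    unfolding is_digits_def
  proof (intro conjI allI impI)
    fix M assume "N \<le> M"
    then obtain i where "M = N + int i" using zle_iff_zadd by blast
    then show "padic_norm (\<beta> - digit_sum c N M) \<le> real CARD('p) powi (- M)"
      using S[of i] b1[of i]
      by (simp add: padic_norm_mult P_def padic_norm_CARD_powi mult_left_le padic_norm_nonneg)
  qed (use dg b1 CARD_gt_1[where ?'p='p] in \<open>auto simp: c_def\<close>)
  then show thesis by (rule that)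
qed

text \<open>The infinite sum does not mention the starting index, so going through
  \<open>has_sum\<close> allows it to be lowered. Two expansions can thus be given a common
  start.\<close>

lemma is_digits_mono:
  fixes \<beta> :: "'p::prime_index padic"
  assumes "is_digits c N \<beta>" "N' \<le> N"
  shows "is_digits c N' \<beta>"
proof -
  have b: "\<forall>n. c n < CARD('p)" "\<forall>n<N. c n = 0" using assms(1) by (auto simp: is_digits_def)
  then have "\<forall>n<N'. c n = 0" using assms(2) by auto
  then show ?thesis
    using has_sum_iff_is_digits[OF b] has_sum_iff_is_digits[OF b(1)] assms(1) by blast
qed

text \<open>Existence and uniqueness justify the definite description. The start is taken at most 0
  because the digits are later cut at exponents 0 and 1.\<close>

lemma is_digits_padic_digits:
  fixes \<beta> :: "'p::prime_index padic"
  obtains N where "N \<le> 0" "is_digits (padic_digits \<beta>) N \<beta>"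
proof -
  obtain c N where c: "is_digits c N \<beta>" by (rule is_digits_exists)
  have "padic_digits \<beta> = c"
    unfolding padic_digits_def
  proof (rule the_equality)
    show "(\<forall>n. c n < CARD('p)) \<and> (\<exists>N. \<forall>n<N. c n = 0) \<and>
        ((\<lambda>n. of_nat (c n) * of_nat CARD('p) powi n) has_sum \<beta>) UNIV"
      using c has_sum_iff_is_digits[of c N \<beta>] by (auto simp: is_digits_def)
  next
    fix c' :: "int \<Rightarrow> nat"
    assume c': "(\<forall>n. c' n < CARD('p)) \<and> (\<exists>N. \<forall>n<N. c' n = 0) \<and>
        ((\<lambda>n. of_nat (c' n) * of_nat CARD('p) powi n) has_sum \<beta>) UNIV"
    then obtain N' where "is_digits c' N' \<beta>" using has_sum_iff_is_digits[of c' _ \<beta>] by blast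
    then show "c' = c"
      using is_digits_unique is_digits_mono[OF c] is_digits_mono by (metis linorder_linear)
  qed
  then show thesis using that[of "min N 0"] is_digits_mono[OF c] by simp
qed

text \<open>The truncation before M is then itself of norm at most p to the minus M, so
  \<open>small_digit_sum\<close> makes its digits vanish.\<close>

lemma is_digits_small:
  fixes \<beta> :: "'p::prime_index padic"
  assumes c: "is_digits c N \<beta>" and M: "N \<le> M" "padic_norm \<beta> \<le> real CARD('p) powi (- M)" and n: "n < M"
  shows "c n = 0"
proof (cases "n < N")
  case False
  have "padic_norm (\<beta> - (\<beta> - digit_sum c N M)) \<le> real CARD('p) powi (- M)"
    by (rule order_trans[OF padic_norm_diff]) (use c M in \<open>auto simp: is_digits_def\<close>)
  then have "int (c n) = 0"
    by (intro small_digit_sum[where d = "\<lambda>n. int (c n)" and N = N and M = M and ?'p = 'p])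
      (use c M n False in \<open>auto simp: is_digits_def digit_sum_def\<close>)
  then show ?thesis by simp
qed (use c in \<open>simp add: is_digits_def\<close>)

section \<open>Order, zeroth digit and fractional part in terms of the norm\<close>

lemma padic_norm_eq_val:
  fixes \<beta> :: "'p::prime_index padic"
  assumes "\<beta> \<noteq> 0"
  shows "padic_norm \<beta> = real CARD('p) powi (- padic_val \<beta>)"
proof -
  obtain N where N: "is_digits (padic_digits \<beta>) N \<beta>" by (rule is_digits_padic_digits)
  let ?c = "padic_digits \<beta>"
  have z: "?c n = 0" if "n < N" for n using N that by (simp add: is_digits_def)
  have "\<exists>n. ?c n \<noteq> 0"
  \<comment> \<open>If all digits were 0, every truncation would vanish and the norm would be below
    every power of p.\<close>
  proof (rule ccontr)
    assume "\<nexists>n. ?c n \<noteq> 0"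
    then have s: "padic_norm \<beta> \<le> real CARD('p) powi (- M)" if "N \<le> M" for M
      using N that by (simp add: is_digits_def digit_sum_def)
    have "0 < padic_norm \<beta>" using assms padic_norm_nonneg[of \<beta>] by (simp add: less_le)
    moreover have "inverse (real CARD('p)) < 1" using CARD_gt_1[where ?'p='p] by (simp add: field_simps)
    ultimately obtain k where "inverse (real CARD('p)) ^ k < padic_norm \<beta>"
      using real_arch_pow_inv by blast
    moreover have "real CARD('p) powi (- max N (int k)) \<le> real CARD('p) powi (- int k)" by simp
    moreover have "inverse (real CARD('p)) ^ k = real CARD('p) powi (- int k)"
      by (simp add: power_int_minus power_inverse)
    ultimately show False using s[of "max N (int k)"] by linarith
  qed
  then obtain n where n: "?c n \<noteq> 0" by blast
  \<comment> \<open>\<open>LEAST\<close> over the integers needs an actual minimum; the digits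
    vanish below N, so a least natural offset from N provides it.\<close>
  have "\<exists>m. ?c m \<noteq> 0 \<and> (\<forall>k. ?c k \<noteq> 0 \<longrightarrow> m \<le> k)"
  proof -
    define i where "i = (LEAST i. ?c (N + int i) \<noteq> 0)"
    have ex: "?c (N + int (nat (n - N))) \<noteq> 0" using n z[of n] by (cases "n < N") auto
    have "?c (N + int i) \<noteq> 0" using ex unfolding i_def by (rule LeastI)
    moreover have "N + int i \<le> k" if "?c k \<noteq> 0" for k
    proof -
      have "N \<le> k" using z[of k] that by force
      then have "i \<le> nat (k - N)" unfolding i_def using that by (intro Least_le) simp
      then show ?thesis using \<open>N \<le> k\<close> by simp
    qed
    ultimately show ?thesis by blast
  qed
  then obtain m where m: "?c m \<noteq> 0" "\<And>k. ?c k \<noteq> 0 \<Longrightarrow> m \<le> k" by blast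
  have val: "padic_val \<beta> = m" unfolding padic_val_def by (rule Least_equality) (use m in auto)
  have "N \<le> m" using m(1) z[of m] by force
  then have s: "{N..<m + 1} = insert m {N..<m}" by auto
  \<comment> \<open>Just past m the truncation is the leading term alone. Its digit is prime to p,
    so this term dominates the remaining error.\<close>
  have "digit_sum ?c N (m + 1) = (of_nat (?c m) * of_nat CARD('p) powi m :: 'p padic)"
    unfolding digit_sum_def s using m(2) by (force intro: sum.neutral)
  then have d: "padic_norm (\<beta> - of_nat (?c m) * of_nat CARD('p) powi m) \<le> real CARD('p) powi (- (m + 1))"
    using N \<open>N \<le> m\<close> by (metis is_digits_def le_add_same_cancel1 order_trans zero_le_one)
  have "?c m < CARD('p)" using N by (simp add: is_digits_def)
  then have "\<not> int CARD('p) dvd int (?c m)" using m(1) by (simp add: nat_dvd_not_less)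
  then have "padic_norm (of_int (int (?c m)) :: 'p padic) = 1"
    using padic_norm_of_int_dvd_iff padic_norm_of_int_le by (metis order_le_less)
  then have t: "padic_norm (of_nat (?c m) * of_nat CARD('p) powi m :: 'p padic) = real CARD('p) powi (- m)"
    by (simp add: padic_norm_mult padic_norm_CARD_powi)
  have "\<not> real CARD('p) powi (- m) \<le> real CARD('p) powi (- (m + 1))"
    unfolding CARD_powi_le_iff by simp
  then have "padic_norm (\<beta> - of_nat (?c m) * of_nat CARD('p) powi m) < real CARD('p) powi (- m)"
    using d by linarith
  then show ?thesis
    using padic_norm_add_eq[of "\<beta> - of_nat (?c m) * of_nat CARD('p) powi m"
        "of_nat (?c m) * of_nat CARD('p) powi m"] t by (simp add: val)
qed

text \<open>A p-adic integer has no digits below 0, so its truncation before exponent 1 is the digit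
  at 0.\<close>

lemma padic_norm_diff_omega:
  fixes \<beta> :: "'p::prime_index padic"
  assumes "padic_norm \<beta> \<le> 1"
  shows "padic_norm (\<beta> - of_nat (padic_omega \<beta>)) < 1"
proof -
  let ?c = "padic_digits \<beta>"
  obtain N where N: "N \<le> 0" "is_digits ?c N \<beta>" by (rule is_digits_padic_digits)
  have z: "?c n = 0" if "n < 0" for n using is_digits_small[OF N(2,1)] assms that by simp
  have "{N..<1} = insert 0 {N..<0}" using N by auto
  then have "digit_sum ?c N 1 = (of_nat (?c 0) :: 'p padic)"
    unfolding digit_sum_def using z by (simp add: sum.neutral)
  then have "padic_norm (\<beta> - of_nat (padic_omega \<beta>)) \<le> real CARD('p) powi (- 1)"
    using N unfolding padic_omega_def by (metis is_digits_def order_trans zero_le_one)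
  also have "\<dots> < 1" using CARD_gt_1[where ?'p='p] by (simp add: power_int_minus field_simps)
  finally show ?thesis .
qed

text \<open>What \<open>padic_frac\<close> removes from \<open>\<beta>\<close> is the truncation
  before exponent 1, a finite and hence rational sum. The orbit argument uses
  \<open>padic_frac\<close> through these two facts.\<close>

lemma padic_frac_props:
  fixes \<beta> :: "'p::prime_index padic"
  shows "padic_norm (padic_frac \<beta>) < 1"
    and "\<exists>s. \<beta> - padic_frac \<beta> = of_rat s \<and> (s = 0 \<or> 1 \<le> padic_norm (of_rat s :: 'p padic))"
proof -
  let ?c = "padic_digits \<beta>"
  obtain N where N: "N \<le> 0" "is_digits ?c N \<beta>" by (rule is_digits_padic_digits)
  have lt: "?c n < CARD('p)" for n using N by (simp add: is_digits_def)
  define c' where "c' = (\<lambda>n. if 1 \<le> n then ?c n else 0)"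
  define S :: "'p padic" where "S = digit_sum ?c N 1"
  have "is_digits c' 1 (\<beta> - S)"
    unfolding is_digits_def
  proof (intro conjI allI impI)
    fix M :: int assume M: "1 \<le> M"
    have "{N..<M} = {N..<1} \<union> {1..<M}" using M N by auto
    then have "digit_sum ?c N M = S + digit_sum c' 1 M"
      by (simp add: S_def digit_sum_def sum.union_disjoint c'_def)
    moreover have "padic_norm (\<beta> - digit_sum ?c N M) \<le> real CARD('p) powi (- M)"
      using N M by (simp add: is_digits_def)
    ultimately show "padic_norm (\<beta> - S - digit_sum c' 1 M) \<le> real CARD('p) powi (- M)"
      by (simp add: algebra_simps)
  qed (use lt CARD_gt_1[where ?'p='p] in \<open>auto simp: c'_def\<close>)
  then have "((\<lambda>n. of_nat (c' n) * of_nat CARD('p) powi n) has_sum (\<beta> - S)) UNIV"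
    using has_sum_iff_is_digits[of c' 1 "\<beta> - S"] by (auto simp: is_digits_def)
  also have "?this \<longleftrightarrow> ((\<lambda>n. of_nat (?c n) * of_nat CARD('p) powi n) has_sum (\<beta> - S)) {1..}"
    by (rule has_sum_cong_neutral) (auto simp: c'_def)
  finally have frac: "padic_frac \<beta> = \<beta> - S" unfolding padic_frac_def by (rule infsumI)
  have "padic_norm (\<beta> - S) \<le> real CARD('p) powi (- 1)"
    using N unfolding S_def is_digits_def by (meson order_trans zero_le_one)
  also have "\<dots> < 1" using CARD_gt_1[where ?'p='p] by (simp add: power_int_minus field_simps)
  finally show "padic_norm (padic_frac \<beta>) < 1" unfolding frac .
  define s :: rat where "s = (\<Sum>n\<in>{N..<1}. of_nat (?c n) * of_nat CARD('p) powi n)"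
  have S: "S = of_rat s"
    by (simp add: S_def s_def digit_sum_def of_rat_sum of_rat_mult of_rat_power_int)
  \<comment> \<open>A norm below 1 is at most 1 / p, which is the precision needed to force every
    digit of this truncation to be 0.\<close>
  have "s = 0" if "padic_norm (of_rat s :: 'p padic) < 1"
  proof -
    have "padic_norm (\<Sum>n\<in>{N..<1}. of_int (int (?c n)) * of_nat CARD('p) powi n :: 'p padic)
        \<le> real CARD('p) powi (- 1)"
      using padic_norm_of_rat_less_1[OF that] by (simp add: S[symmetric] S_def digit_sum_def)
    then have "int (?c n) = 0" if "n \<in> {N..<1}" for n
      by (rule small_digit_sum[where d = "\<lambda>n. int (?c n)", rotated 2]) (use N lt that in auto)
    then show ?thesis by (simp add: s_def)
  qed
  then show "\<exists>s. \<beta> - padic_frac \<beta> = of_rat s \<and> (s = 0 \<or> 1 \<le> padic_norm (of_rat s :: 'p padic))"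
    using frac S by (auto simp: not_less)
qed


lemma padic_norm_le_1_iff_ord: "padic_norm \<beta> \<le> 1 \<longleftrightarrow> \<beta> \<in> padic_integers"
proof (cases "\<beta> = 0")
  case False
  have "padic_norm \<beta> \<le> real CARD('a) powi 0 \<longleftrightarrow> 0 \<le> padic_val \<beta>"
    unfolding padic_norm_eq_val[OF False] CARD_powi_le_iff by simp
  then show ?thesis using False by (simp add: padic_integers_def padic_ord_def zero_extended_def)
qed (simp add: padic_integers_def padic_ord_def)

lemma padic_norm_eq_1_if_ord_0: "padic_ord \<beta> = 0 \<Longrightarrow> padic_norm \<beta> = 1"
  using padic_norm_eq_val[of \<beta>] by (auto simp: padic_ord_def zero_extended_def split: if_splits)

section \<open>Quadratic irrationals\<close>

lemma rat_lin_eq_0: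
  fixes z :: "'a::field_char_0"
  assumes z: "z \<notin> \<rat>" and eq: "of_rat s + of_rat t * z = 0"
  shows "s = 0 \<and> t = 0"
proof -
  have "t = 0"
  proof (rule ccontr)
    assume "t \<noteq> 0"
    then have "z = of_rat (- s / t)" using eq by (simp add: of_rat_divide of_rat_minus field_simps eq_neg_iff_add_eq_0)
    then show False using z by simp
  qed
  then show ?thesis using eq by simp
qed

lemma rat_lin_unique:
  fixes z :: "'a::field_char_0"
  assumes z: "z \<notin> \<rat>" and eq: "of_rat s + of_rat t * z = of_rat s' + of_rat t' * z"
  shows "s = s' \<and> t = t'"
  using rat_lin_eq_0[OF z, of "s - s'" "t - t'"] eq by (simp add: of_rat_diff algebra_simps)

lemma rat_coords_eq:
  assumes "z \<notin> \<rat>"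
  shows "rat_coords z (of_rat s + of_rat t * z) = (s, t)"
  unfolding rat_coords_def by (rule the_equality) (use rat_lin_unique[OF assms] in auto)

text \<open>Otherwise 1, z and x would be three independent elements in the span of a basis with two
  elements.\<close>

lemma quadratic_field_basis:
  fixes z :: "'a::field_char_0"
  assumes K: "rat_dim K = 2" "z \<in> K" "1 \<in> K" and z: "z \<notin> \<rat>" and x: "x \<in> K"
  obtains s t where "x = of_rat s + of_rat t * z"
proof -
  obtain B where B: "\<not> rat_vs.dependent B" "rat_vs.span B = rat_vs.span K" "card B = 2"
  proof -
    let ?P = "\<lambda>b. \<not> rat_vs.dependent b \<and> rat_vs.span b = rat_vs.span K"
    \<comment> \<open>\<open>rat_vs.dim\<close> is the cardinality of a chosen basis, with default 0
      if there is none; the value 2 excludes the default.\<close>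
    have ex: "\<exists>b. ?P b" using K(1) unfolding rat_vs.dim_def by (auto split: if_splits)
    then have "card (SOME b. ?P b) = 2" using K(1) unfolding rat_vs.dim_def by simp
    then show thesis using someI_ex[OF ex] that by blast
  qed
  have fin: "finite B" using B(3) by (simp add: card_ge_0_finite)
  have sub: "K \<subseteq> rat_vs.span B" unfolding B(2) by (rule rat_vs.span_superset)
  have z1: "z \<notin> rat_vs.span {1}" using z by (auto simp: rat_vs.span_singleton)
  have ne: "z \<noteq> 1" using z by auto
  have ind: "\<not> rat_vs.dependent {z, 1}" using z1 by (simp add: rat_vs.independent_insert)
  have "x \<in> rat_vs.span {z, 1}"
  proof (rule ccontr)
    assume x': "x \<notin> rat_vs.span {z, 1}"
    then have "x \<notin> {z, 1}" using rat_vs.span_superset by blast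
    then have "card {x, z, 1} = 3" using ne by auto
    moreover have "\<not> rat_vs.dependent {x, z, 1}" using ind x' by (subst rat_vs.independent_insert) auto
    then have "card {x, z, 1} \<le> card B"
      using rat_vs.independent_span_bound[OF fin, of "{x, z, 1}"] sub K x by auto
    ultimately show False using B(3) by simp
  qed
  then obtain t s where "x - of_rat t * z = of_rat s * 1"
    by (auto simp: rat_vs.span_insert[of z] rat_vs.span_singleton)
  then show thesis using that[of s t] by (simp add: algebra_simps)
qed

text \<open>A nonzero annihilating polynomial of degree below 2 would make z rational, and two monic
  ones of degree 2 differ by a linear relation, which is trivial. This gives access to the
  coefficients in \<open>condition_H\<close>.\<close>

lemma min_poly_quadratic:
  fixes z :: "'a::field_char_0"
  assumes z: "z \<notin> \<rat>" and root: "z\<^sup>2 + of_rat a * z + of_rat b = 0"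
  shows "min_poly z = [:b, a, 1:]"
proof -
  have deg: "2 \<le> degree g" if g: "g \<noteq> 0" "poly (map_poly of_rat g) z = 0" for g :: "rat poly"
  proof (rule ccontr)
    assume "\<not> 2 \<le> degree g"
    moreover obtain c d r where "g = pCons c (pCons d r)" by (metis pCons_cases)
    ultimately obtain c d where gcd: "g = [:c, d:]" by (cases "r = 0") auto
    then have "of_rat c + of_rat d * z = 0" using g(2) by (simp add: map_poly_pCons mult.commute)
    then show False using rat_lin_eq_0[OF z] g(1) gcd by fastforce
  qed
  have rt: "poly (map_poly of_rat [:b, a, 1:]) z = 0"
    using root by (simp add: map_poly_pCons power2_eq_square algebra_simps)
  show ?thesis
    unfolding min_poly_def
  proof (rule the_equality)
    show "lead_coeff [:b, a, 1:] = 1 \<and> poly (map_poly of_rat [:b, a, 1:]) z = 0 \<and>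
        (\<forall>g. g \<noteq> 0 \<and> poly (map_poly of_rat g) z = 0 \<longrightarrow> degree [:b, a, 1:] \<le> degree g)"
      using deg rt by (auto simp: numeral_2_eq_2)
  next
    fix f :: "rat poly"
    assume f: "lead_coeff f = 1 \<and> poly (map_poly of_rat f) z = 0 \<and>
        (\<forall>g. g \<noteq> 0 \<and> poly (map_poly of_rat g) z = 0 \<longrightarrow> degree f \<le> degree g)"
    then have "f \<noteq> 0" by auto
    moreover have "degree f \<le> degree [:b, a, 1:]" using f rt by (metis pCons_eq_0_iff one_neq_zero)
    ultimately have d: "degree f = 2" using deg[of f] f by simp
    obtain c0 c1 c2 r where fr: "f = pCons c0 (pCons c1 (pCons c2 r))" by (metis pCons_cases)
    then have "r = 0" using d by (auto split: if_splits)
    then have fe: "f = [:c0, c1, 1:]" using f d fr by (auto simp: numeral_2_eq_2)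
    then have "z\<^sup>2 + of_rat c1 * z + of_rat c0 = 0"
      using f by (simp add: map_poly_pCons power2_eq_square algebra_simps)
    then have "of_rat c0 + of_rat c1 * z = - z\<^sup>2"
      by (simp add: eq_neg_iff_add_eq_0 algebra_simps)
    also have "\<dots> = of_rat b + of_rat a * z"
      using root by (subst eq_commute) (simp add: eq_neg_iff_add_eq_0 algebra_simps)
    finally show "f = [:b, a, 1:]" using rat_lin_unique[OF z] fe by blast
  qed
qed

section \<open>Numerators, denominators and prime-to-p parts\<close>

lemma coprime_part_pos_coprime:
  "0 < coprime_part p r" "coprime (coprime_part p r) p"
proof -
  have "0 < coprime_part p r \<and> coprime (coprime_part p r) p"
  proof (cases "r = 0")
    case False
    let ?P = "\<lambda>d. d > 0 \<and> coprime d p \<and> int d dvd fst (quotient_of r)"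
    have n: "fst (quotient_of r) \<noteq> 0"
      using False quotient_of_div[of r "fst (quotient_of r)" "snd (quotient_of r)"] by auto
    \<comment> \<open>\<open>GREATEST\<close> is attained because 1 is a candidate and the nonzero
      numerator bounds all candidates.\<close>
    have "?P (GREATEST d. ?P d)"
    proof (rule GreatestI_nat)
      show "?P 1" by simp
      show "d \<le> nat \<bar>fst (quotient_of r)\<bar>" if "?P d" for d
        using n that by (auto dest!: zdvd_imp_le[of _ "\<bar>fst (quotient_of r)\<bar>", simplified] simp: le_nat_iff)
    qed
    then show ?thesis using False by (simp add: coprime_part_def)
  qed (simp add: coprime_part_def)
  then show "0 < coprime_part p r" "coprime (coprime_part p r) p" by auto
qed

text \<open>The whole numerator is then the largest candidate, so dividing r by it leaves plus or
  minus 1 over the denominator.\<close>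

lemma coprime_part_eq_numerator:
  assumes r: "r \<noteq> 0" and cop: "coprime (fst (quotient_of r)) (int p)"
  shows "int (coprime_part p r) = \<bar>fst (quotient_of r)\<bar>"
proof -
  let ?n = "fst (quotient_of r)"
  have n: "?n \<noteq> 0" using r quotient_of_div[of r ?n "snd (quotient_of r)"] by auto
  have "(GREATEST d. d > 0 \<and> coprime d p \<and> int d dvd ?n) = nat \<bar>?n\<bar>"
  proof (rule Greatest_equality)
    have "coprime (int (nat \<bar>?n\<bar>)) (int p)" using cop by simp
    then have "coprime (nat \<bar>?n\<bar>) p" by (simp only: coprime_int_iff)
    then show "nat \<bar>?n\<bar> > 0 \<and> coprime (nat \<bar>?n\<bar>) p \<and> int (nat \<bar>?n\<bar>) dvd ?n"
      using n by simp
  qed (use n in \<open>auto dest!: zdvd_imp_le[of _ "\<bar>fst (quotient_of r)\<bar>", simplified] simp: le_nat_iff\<close>)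
  then show ?thesis using r by (simp add: coprime_part_def)
qed

lemma padic_norm_coprime:
  assumes "coprime k (int CARD('p::prime_index))"
  shows "padic_norm (of_int k :: 'p padic) = 1"
proof -
  have "\<not> int CARD('p) dvd k"
    using assms prime_CARD[where 'a='p] by (metis coprime_absorb_right not_prime_unit prime_nat_int_transfer)
  then show ?thesis
    using padic_norm_of_int_dvd_iff[where ?'p='p, of k] padic_norm_of_int_le[where ?'p='p, of k] by simp
qed

text \<open>Numerator and denominator have equal norm, so p would divide both or neither, and they
  are coprime.\<close>

lemma padic_norm_numerator:
  assumes "padic_norm (of_rat r :: 'p::prime_index padic) = 1"
  shows "coprime (fst (quotient_of r)) (int CARD('p))"
proof (rule ccontr)
  obtain n d where q: "quotient_of r = (n, d)" by (cases "quotient_of r")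
  have d: "d > 0" and re: "r = of_int n / of_int d" and cop: "coprime n d"
    using quotient_of_denom_pos[OF q] quotient_of_div[OF q] quotient_of_coprime[OF q] by auto
  have pp: "prime (int CARD('p))" using prime_CARD[where 'a='p] by simp
  have nd: "padic_norm (of_int n :: 'p padic) = padic_norm (of_int d :: 'p padic)"
    using assms d by (auto simp: re of_rat_divide padic_norm_divide divide_eq_eq split: if_splits)
  assume "\<not> coprime (fst (quotient_of r)) (int CARD('p))"
  then have n: "int CARD('p) dvd n" using pp q by (metis coprime_commute fst_conv prime_imp_coprime)
  then have "int CARD('p) dvd d" using nd padic_norm_of_int_dvd_iff[where ?'p='p] by metis
  then have "is_unit (int CARD('p))" using cop n coprime_common_divisor by blast
  then show False using pp by (simp add: not_prime_unit)
qed

text \<open>The reduced denominator divides the denominator of any other representation.\<close>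

lemma quotient_of_denom_le:
  assumes "r = of_int x / of_int y" "0 < y"
  shows "snd (quotient_of r) \<le> y"
proof -
  obtain n d where q: "quotient_of r = (n, d)" by (cases "quotient_of r")
  have d: "d > 0" and re: "r = of_int n / of_int d" and cop: "coprime n d"
    using quotient_of_denom_pos[OF q] quotient_of_div[OF q] quotient_of_coprime[OF q] by auto
  have "(of_int (n * y) :: rat) = of_int (x * d)" using re assms d by (simp add: field_simps)
  then have "n * y = x * d" by (simp only: of_int_eq_iff)
  then have "d dvd n * y" by simp
  then have "d dvd y" using cop by (simp add: coprime_commute coprime_dvd_mult_right_iff)
  then show ?thesis using assms(2) q by (simp add: zdvd_imp_le)
qed

section \<open>The orbit of the continued fraction map\<close>

text \<open>These norm conditions carry \<open>condition_H\<close> into the orbit argument: a is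
  minus the trace of z, and since it is a unit while z is small, the conjugate - a - z is a
  unit.\<close>

locale quadratic_padic =
  fixes z :: "'p::prime_index padic" and a b :: rat and \<epsilon> :: int
  assumes irr: "z \<notin> \<rat>" and root: "z\<^sup>2 + of_rat a * z + of_rat b = 0"
    and norm_a: "padic_norm (of_rat a :: 'p padic) = 1" and norm_z: "padic_norm z < 1"
    and eps: "\<epsilon> \<in> {- 1, 1}"
begin

lemma z_nonzero: "z \<noteq> 0"
  using irr by auto

lemma norm_eps: "padic_norm (of_int \<epsilon> :: 'p padic) = 1"
  using eps by (auto simp: padic_norm_minus)

text \<open>The power of p normalises the quotient to a unit, and subtracting its digit at 0 leaves
  norm below 1.\<close>

lemma cf_remainder_small:
  fixes \<alpha> :: "'p padic"
  assumes "\<alpha> \<noteq> 0"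
  shows "padic_norm (cf_remainder \<epsilon> \<alpha>) < 1"
proof -
  have "padic_norm (of_int \<epsilon> * of_nat CARD('p) powi padic_val \<alpha> / \<alpha>) = 1"
    using padic_norm_eq_val[OF assms] CARD_gt_1[where ?'p='p]
    by (simp add: padic_norm_mult padic_norm_divide norm_eps padic_norm_CARD_powi)
  then show ?thesis
    using assms padic_norm_diff_omega[of "of_int \<epsilon> * of_nat CARD('p) powi padic_val \<alpha> / \<alpha>"]
    by (simp add: cf_remainder_def Let_def)
qed

text \<open>The divisor a' is prime to p, so it preserves norms, and removing the fractional part
  changes only the rational coordinate.\<close>

lemma cf_map_eq:
  assumes "cf_remainder \<epsilon> \<alpha> = of_rat g0 + of_rat q * z"
  obtains s where
    "cf_map \<epsilon> z \<alpha> = of_rat s + of_rat (q / of_nat (coprime_part CARD('p) q)) * z"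
    "s = 0 \<or> 1 \<le> padic_norm (of_rat s :: 'p padic)"
    "\<alpha> \<noteq> 0 \<Longrightarrow> padic_norm (cf_map \<epsilon> z \<alpha>) < 1"
proof -
  define a' where "a' = coprime_part CARD('p) q"
  have a': "0 < a'" "padic_norm (of_nat a' :: 'p padic) = 1"
    using coprime_part_pos_coprime[of "CARD('p)" q] padic_norm_coprime[where ?'p='p, of "int a'"]
    by (simp_all add: a'_def)
  let ?\<beta> = "of_rat (g0 / of_nat a') :: 'p padic"
  have T: "cf_map \<epsilon> z \<alpha> = cf_remainder \<epsilon> \<alpha> / of_nat a' - padic_frac ?\<beta>"
    unfolding cf_map_def assms by (simp add: rat_coords_eq[OF irr] a'_def Let_def)
  obtain s where s: "?\<beta> - padic_frac ?\<beta> = of_rat s" "s = 0 \<or> 1 \<le> padic_norm (of_rat s :: 'p padic)"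
    using padic_frac_props(2) by blast
  have "cf_map \<epsilon> z \<alpha> = (?\<beta> - padic_frac ?\<beta>) + of_rat (q / of_nat a') * z"
    unfolding T assms by (simp add: of_rat_divide add_divide_distrib)
  then have "cf_map \<epsilon> z \<alpha> = of_rat s + of_rat (q / of_nat (coprime_part CARD('p) q)) * z"
    unfolding s(1) by (simp add: a'_def)
  moreover have "padic_norm (cf_map \<epsilon> z \<alpha>) < 1" if "\<alpha> \<noteq> 0"
    unfolding T
    using padic_norm_diff[of "cf_remainder \<epsilon> \<alpha> / of_nat a'" "padic_frac ?\<beta>"]
      cf_remainder_small[OF that] padic_frac_props(1)[of ?\<beta>] a' by (simp add: padic_norm_divide)
  ultimately show thesis using that s(2) by blast
qed

text \<open>The z-coordinate is 0, so the image is a rational s of norm below 1, and the alternative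
  in \<open>cf_map_eq\<close> leaves only s = 0.\<close>

lemma cf_map_rational:
  assumes "\<alpha> \<in> \<rat>" "\<alpha> \<noteq> 0"
  shows "cf_map \<epsilon> z \<alpha> = 0"
proof -
  obtain r where r: "\<alpha> = of_rat r" using assms(1) by (auto elim: Rats_cases)
  have g: "cf_remainder \<epsilon> \<alpha> = of_rat (of_int \<epsilon> * of_nat CARD('p) powi padic_val \<alpha> / r
      - of_nat (padic_omega (of_int \<epsilon> * of_nat CARD('p) powi padic_val \<alpha> / \<alpha>))) + of_rat 0 * z"
    using assms(2)
    by (simp add: cf_remainder_def Let_def r of_rat_diff of_rat_divide of_rat_mult of_rat_power_int)
  show ?thesis
    by (rule cf_map_eq[OF g]) (use assms(2) in auto)
qed

section \<open>The conjugate and the irrational coordinate of the remainder\<close>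

definition conj_norm :: "rat \<Rightarrow> rat \<Rightarrow> rat" where
  "conj_norm s t = s\<^sup>2 - a * s * t + b * t\<^sup>2"

text \<open>The minus sign comes from the z-coordinate - t of the conjugate s - t a - t z.\<close>

definition next_coeff :: "rat \<Rightarrow> rat \<Rightarrow> rat" where
  "next_coeff s t = - (of_int \<epsilon> * of_nat CARD('p) powi padic_val (of_rat s + of_rat t * z) * t / conj_norm s t)"

lemma conj_norm_eq:
  "of_rat (conj_norm s t) = (of_rat s + of_rat t * z) * (of_rat (s - t * a) + of_rat (- t) * z)"
proof -
  \<comment> \<open>A polynomial identity that exhibits the defining relation of z as a factor of
    the error term, which \<open>root\<close> then removes.\<close>
  have "(S + T * z) * (S - T * A + (- T) * z) = S\<^sup>2 - A * S * T + B * T\<^sup>2 - T\<^sup>2 * (z\<^sup>2 + A * z + B)"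
    for S T A B by (simp add: power2_eq_square algebra_simps)
  from this[of "of_rat s" "of_rat t" "of_rat a" "of_rat b"] show ?thesis
    unfolding root by (simp add: conj_norm_def of_rat_diff of_rat_mult of_rat_add of_rat_power of_rat_minus)
qed

lemma
  assumes "t \<noteq> 0"
  shows lin_nonzero: "of_rat s + of_rat t * z \<noteq> 0" and conj_norm_nonzero: "conj_norm s t \<noteq> 0"
    and next_coeff_nonzero: "next_coeff s t \<noteq> 0"
proof -
  show l: "of_rat s + of_rat t * z \<noteq> 0" using rat_lin_eq_0[OF irr] assms by blast
  have "of_rat (s - t * a) + of_rat (- t) * z \<noteq> 0" using rat_lin_eq_0[OF irr, of "s - t * a" "- t"] assms by auto
  then have "(of_rat (conj_norm s t) :: 'p padic) \<noteq> 0" unfolding conj_norm_eq using l by simp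
  then show n: "conj_norm s t \<noteq> 0" by auto
  show "next_coeff s t \<noteq> 0" using n assms eps by (auto simp: next_coeff_def)
qed

text \<open>Rationalise the denominator with the conjugate; subtracting the integer digit affects
  only the rational coordinate.\<close>

lemma cf_remainder_eq:
  assumes t: "t \<noteq> 0"
  shows "\<exists>g0. cf_remainder \<epsilon> (of_rat s + of_rat t * z) = of_rat g0 + of_rat (next_coeff s t) * z"
proof -
  define \<alpha> where "\<alpha> = of_rat s + of_rat t * z"
  define e where "e = of_int \<epsilon> * (of_nat CARD('p) :: rat) powi padic_val \<alpha>"
  define N where "N = conj_norm s t"
  have nz: "\<alpha> \<noteq> 0" "N \<noteq> 0" using lin_nonzero[OF t] conj_norm_nonzero[OF t] by (simp_all add: \<alpha>_def N_def)
  have e: "of_rat e = of_int \<epsilon> * (of_nat CARD('p) :: 'p padic) powi padic_val \<alpha>"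
    by (simp add: e_def of_rat_mult of_rat_power_int)
  have q: "next_coeff s t = e * (- t) / N" by (simp add: next_coeff_def e_def \<alpha>_def N_def)
  have N: "of_rat N = \<alpha> * (of_rat (s - t * a) + of_rat (- t) * z)"
    unfolding N_def \<alpha>_def by (rule conj_norm_eq)
  moreover have "of_rat N \<noteq> (0 :: 'p padic)" using nz(2) by simp
  ultimately have "of_rat (s - t * a) + of_rat (- t) * z \<noteq> 0" by auto
  then have "of_rat e / \<alpha> = of_rat e * (of_rat (s - t * a) + of_rat (- t) * z) / of_rat N"
    unfolding N by simp
  also have "\<dots> = of_rat (e * (s - t * a) / N) + of_rat (next_coeff s t) * z"
    unfolding q by (simp only: of_rat_divide of_rat_mult of_rat_minus add_divide_distrib distrib_left
        mult.assoc times_divide_eq_left)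
  finally have "cf_remainder \<epsilon> \<alpha> = of_rat (e * (s - t * a) / N - of_nat (padic_omega (of_rat e / \<alpha>)))
      + of_rat (next_coeff s t) * z"
    using nz by (simp add: cf_remainder_def Let_def e of_rat_diff)
  then show ?thesis unfolding \<alpha>_def by blast
qed

text \<open>The shape of every iterate but the zeroth: fractional parts have been removed from the rational coordinate.\<close>

definition reduced :: "rat \<Rightarrow> rat \<Rightarrow> bool" where
  "reduced s t \<longleftrightarrow> t \<noteq> 0 \<and> padic_norm (of_rat s + of_rat t * z) < 1 \<and>
     (s = 0 \<or> 1 \<le> padic_norm (of_rat s :: 'p padic))"

lemma cf_map_irrational:
  assumes t: "t \<noteq> 0"
  shows "\<exists>s' t'. cf_map \<epsilon> z (of_rat s + of_rat t * z) = of_rat s' + of_rat t' * z \<and> reduced s' t'"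
proof -
  obtain g0 where "cf_remainder \<epsilon> (of_rat s + of_rat t * z) = of_rat g0 + of_rat (next_coeff s t) * z"
    using cf_remainder_eq[OF t] by blast
  then obtain s' where "cf_map \<epsilon> z (of_rat s + of_rat t * z)
      = of_rat s' + of_rat (next_coeff s t / of_nat (coprime_part CARD('p) (next_coeff s t))) * z"
    "s' = 0 \<or> 1 \<le> padic_norm (of_rat s' :: 'p padic)"
    "padic_norm (cf_map \<epsilon> z (of_rat s + of_rat t * z)) < 1"
    using cf_map_eq lin_nonzero[OF t] by metis
  moreover have "next_coeff s t / of_nat (coprime_part CARD('p) (next_coeff s t)) \<noteq> 0"
    using next_coeff_nonzero[OF t] coprime_part_pos_coprime(1)[of "CARD('p)"] by simp
  ultimately show ?thesis unfolding reduced_def by metis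
qed

text \<open>The conjugate of \<open>\<alpha>\<close> has norm |t|, so the field norm has size
  |\<open>\<alpha>\<close>| |t|. The power of p has size |\<open>\<alpha>\<close>|, and everything
  cancels.\<close>

lemma norm_next_coeff:
  assumes red: "reduced s t"
  shows "padic_norm (of_rat (next_coeff s t) :: 'p padic) = 1"
proof -
  define \<alpha> where "\<alpha> = of_rat s + of_rat t * z"
  have t: "t \<noteq> 0" and \<alpha>1: "padic_norm \<alpha> < 1"
    and s: "s = 0 \<or> 1 \<le> padic_norm (of_rat s :: 'p padic)"
    using red by (simp_all add: reduced_def \<alpha>_def)
  have \<alpha>0: "\<alpha> \<noteq> 0" using lin_nonzero[OF t] by (simp add: \<alpha>_def)
  have tpos: "0 < padic_norm (of_rat t :: 'p padic)" using t padic_norm_nonneg[of "of_rat t :: 'p padic"] by (simp add: less_le)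
  have less: "padic_norm (of_rat s :: 'p padic) < padic_norm (of_rat t :: 'p padic)"
  proof (cases "s = 0")
    case False
    have eq: "of_rat s = \<alpha> + - (of_rat t * z)" by (simp add: \<alpha>_def)
    \<comment> \<open>If t z were no larger than \<open>\<alpha>\<close>, then s, their difference,
      would have norm below 1. So t z dominates and |s| = |t z|.\<close>
    have "padic_norm \<alpha> < padic_norm (- (of_rat t * z))"
      using s False \<alpha>1 padic_norm_add[of \<alpha> "- (of_rat t * z)"] unfolding eq[symmetric] by linarith
    then have "padic_norm (of_rat s :: 'p padic) = padic_norm (of_rat t :: 'p padic) * padic_norm z"
      using padic_norm_add_eq[of \<alpha> "- (of_rat t * z)"] unfolding eq[symmetric]
      by (simp add: padic_norm_minus padic_norm_mult)
    then show ?thesis using tpos norm_z by simp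
  qed (use tpos in simp)
  have "padic_norm (of_rat a + z) = 1"
    using padic_norm_add_eq[of z "of_rat a"] norm_z norm_a by (simp add: add.commute)
  then have "padic_norm (of_rat (- t) * (of_rat a + z)) = padic_norm (of_rat t :: 'p padic)"
    by (simp add: padic_norm_mult of_rat_minus padic_norm_minus)
  moreover have "of_rat (s - t * a) + of_rat (- t) * z = of_rat s + of_rat (- t) * (of_rat a + z)"
    by (simp add: of_rat_diff of_rat_mult of_rat_minus algebra_simps)
  ultimately have "padic_norm (of_rat (s - t * a) + of_rat (- t) * z) = padic_norm (of_rat t :: 'p padic)"
    using less padic_norm_add_eq[of "of_rat s" "of_rat (- t) * (of_rat a + z)"] by simp
  then have N: "padic_norm (of_rat (conj_norm s t) :: 'p padic) = padic_norm \<alpha> * padic_norm (of_rat t :: 'p padic)"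
    unfolding conj_norm_eq by (simp add: padic_norm_mult \<alpha>_def)
  have "padic_norm (of_rat (next_coeff s t) :: 'p padic)
      = padic_norm \<alpha> * padic_norm (of_rat t :: 'p padic) / padic_norm (of_rat (conj_norm s t) :: 'p padic)"
    unfolding next_coeff_def \<alpha>_def[symmetric]
    by (simp add: of_rat_minus of_rat_mult of_rat_divide of_rat_power_int padic_norm_minus padic_norm_mult
        padic_norm_divide norm_eps padic_norm_CARD_powi padic_norm_eq_val[OF \<alpha>0])
  then show ?thesis unfolding N using \<alpha>0 t by simp
qed

text \<open>With a unit coefficient t' the term t' z has norm below 1, and so has the new iterate.
  Their difference is the rational part, which must then be 0. The numerator of the coefficient is
  prime to p, so it is divided out completely.\<close>

lemma cf_map_reduced:
  assumes red: "reduced s t"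
  shows "\<exists>t'. cf_map \<epsilon> z (of_rat s + of_rat t * z) = of_rat t' * z \<and> reduced 0 t' \<and>
    padic_norm (of_rat t' :: 'p padic) = 1 \<and> \<bar>t'\<bar> = 1 / of_int (snd (quotient_of (next_coeff s t)))"
proof -
  define q where "q = next_coeff s t"
  define a' where "a' = coprime_part CARD('p) q"
  have t: "t \<noteq> 0" using red by (simp add: reduced_def)
  have q: "q \<noteq> 0" "padic_norm (of_rat q :: 'p padic) = 1"
    using next_coeff_nonzero[OF t] norm_next_coeff[OF red] by (simp_all add: q_def)
  obtain g0 where "cf_remainder \<epsilon> (of_rat s + of_rat t * z) = of_rat g0 + of_rat q * z"
    using cf_remainder_eq[OF t] q_def by blast
  then obtain s' where s': "cf_map \<epsilon> z (of_rat s + of_rat t * z) = of_rat s' + of_rat (q / of_nat a') * z"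
    "s' = 0 \<or> 1 \<le> padic_norm (of_rat s' :: 'p padic)"
    "padic_norm (cf_map \<epsilon> z (of_rat s + of_rat t * z)) < 1"
    using cf_map_eq lin_nonzero[OF t] a'_def by metis
  have "padic_norm (of_nat a' :: 'p padic) = 1"
    using coprime_part_pos_coprime[of "CARD('p)" q] padic_norm_coprime[where ?'p='p, of "int a'"]
    by (simp add: a'_def)
  then have n1: "padic_norm (of_rat (q / of_nat a') :: 'p padic) = 1"
    using q by (simp add: of_rat_divide padic_norm_divide)
  then have nz: "padic_norm (of_rat (q / of_nat a') * z) < 1" using norm_z by (simp add: padic_norm_mult)
  have "s' = 0"
    using s' nz padic_norm_diff[of "cf_map \<epsilon> z (of_rat s + of_rat t * z)" "of_rat (q / of_nat a') * z"]
    by auto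
  moreover have "reduced 0 (q / of_nat a')"
    using nz q coprime_part_pos_coprime(1)[of "CARD('p)" q] by (simp add: reduced_def a'_def)
  moreover have "\<bar>q / of_nat a'\<bar> = 1 / of_int (snd (quotient_of q))"
  proof -
    obtain n d where nd: "quotient_of q = (n, d)" by (cases "quotient_of q")
    have "int a' = \<bar>n\<bar>"
      using coprime_part_eq_numerator[OF q(1) padic_norm_numerator[OF q(2)]] nd by (simp add: a'_def)
    then have "(of_nat a' :: rat) = \<bar>of_int n\<bar>" by (metis of_int_abs of_int_of_nat_eq)
    then show ?thesis
      using quotient_of_div[OF nd] quotient_of_denom_pos[OF nd] q(1) nd by (simp add: abs_divide)
  qed
  ultimately show ?thesis using s'(1) n1 unfolding q_def by auto
qed

text \<open>For s = 0 the coefficient is, up to sign, p to the order of z divided by b t. As 1 / t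
  is an integer up to sign equal to d, it does not enlarge the denominator.\<close>

lemma denom_next_coeff_le:
  assumes t: "t \<noteq> 0" "padic_norm (of_rat t :: 'p padic) = 1" "\<bar>t\<bar> = 1 / of_int d"
  shows "snd (quotient_of (next_coeff 0 t)) \<le> snd (quotient_of (of_nat CARD('p) powi padic_val z / b))"
proof -
  have nz: "of_rat t * z \<noteq> 0" using t(1) z_nonzero by simp
  have d: "d \<noteq> 0" using t by auto
  \<comment> \<open>Multiplication by the unit t preserves the order, so the power of p in the
    coefficient is independent of t.\<close>
  have "real CARD('p) powi (- padic_val (of_rat t * z)) = real CARD('p) powi (- padic_val z)"
    using padic_norm_eq_val[OF nz] padic_norm_eq_val[OF z_nonzero] t(2) by (simp add: padic_norm_mult)
  then have "- padic_val (of_rat t * z) = - padic_val z"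
    by (intro antisym) (simp_all only: CARD_powi_le_iff[where ?'p='p, symmetric])
  then have val: "padic_val (of_rat t * z) = padic_val z" by simp
  obtain u w where uw: "quotient_of (of_nat CARD('p) powi padic_val z / b) = (u, w)"
    by (cases "quotient_of (of_nat CARD('p) powi padic_val z / b)")
  obtain \<sigma> :: int where \<sigma>: "\<sigma> \<in> {- 1, 1}" "t = of_int \<sigma> / of_int d"
    using t(3) that[of 1] that[of "- 1"] by (auto simp: abs_if split: if_splits)
  have "b \<noteq> 0" using conj_norm_nonzero[OF t(1), of 0] by (auto simp: conj_norm_def)
  then have "next_coeff 0 t = - (of_int \<epsilon> * (of_nat CARD('p) powi padic_val z / b)) / t"
    using t(1) by (simp add: next_coeff_def conj_norm_def val power2_eq_square)
  also have "\<dots> = of_int (- \<epsilon> * u * d * \<sigma>) / of_int w"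
    unfolding quotient_of_div[OF uw] \<sigma>(2) using \<sigma>(1) d by (auto simp: field_simps)
  finally show ?thesis using quotient_of_denom_le[OF _ quotient_of_denom_pos[OF uw]] uw by (metis snd_conv)
qed

section \<open>Finiteness of the set of late iterates\<close>

lemma orbit_periodic:
  assumes t: "t \<noteq> 0"
  shows "\<exists>m1 m2. m1 < m2 \<and> (cf_map \<epsilon> z ^^ m1) (of_rat s + of_rat t * z) = (cf_map \<epsilon> z ^^ m2) (of_rat s + of_rat t * z)"
proof -
  define f where "f = cf_map \<epsilon> z"
  define \<alpha> where "\<alpha> = of_rat s + of_rat t * z"
  define D where "D = snd (quotient_of (of_nat CARD('p) powi padic_val z / b))"
  \<comment> \<open>\<open>Z\<close> is reached after two steps, but its denominators d are still
    unbounded, since the first one depends on the starting point.\<close>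
  define Z where "Z = {of_rat t * z | t d. reduced 0 t \<and> padic_norm (of_rat t :: 'p padic) = 1 \<and>
    \<bar>t\<bar> = 1 / of_int d}"
  \<comment> \<open>\<open>F\<close> is the finite set of candidates with denominator at most
    \<open>D\<close>; one further step from \<open>Z\<close> lands in it.\<close>
  define F where "F = (\<lambda>t. of_rat t * z) ` (\<lambda>(\<sigma>, d). of_int \<sigma> / of_int d) ` ({- 1, 1 :: int} \<times> {0<..D})"
  obtain s1 t1 where 1: "f \<alpha> = of_rat s1 + of_rat t1 * z" "reduced s1 t1"
    using cf_map_irrational[OF t] unfolding f_def \<alpha>_def by blast
  have 2: "f (f \<alpha>) \<in> Z" using cf_map_reduced[OF 1(2)] unfolding 1 by (auto simp: f_def Z_def)
  have ZF: "f x \<in> Z \<inter> F" if xZ: "x \<in> Z" for x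
  proof -
    obtain t d where x: "x = of_rat t * z" "reduced 0 t" "padic_norm (of_rat t :: 'p padic) = 1" "\<bar>t\<bar> = 1 / of_int d"
      using xZ unfolding Z_def by blast
    obtain t' where t': "f x = of_rat t' * z" "reduced 0 t'" "padic_norm (of_rat t' :: 'p padic) = 1"
      "\<bar>t'\<bar> = 1 / of_int (snd (quotient_of (next_coeff 0 t)))"
      using cf_map_reduced[OF x(2)] x(1) by (auto simp: f_def)
    define d' where "d' = snd (quotient_of (next_coeff 0 t))"
    have "0 < d'" unfolding d'_def by (metis prod.collapse quotient_of_denom_pos)
    moreover have "d' \<le> D"
      unfolding d'_def D_def by (rule denom_next_coeff_le[OF _ x(3,4)]) (use x(2) in \<open>simp add: reduced_def\<close>)
    moreover have "t' = of_int 1 / of_int d' \<or> t' = of_int (- 1) / of_int d'"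
      using t'(4) by (auto simp: d'_def abs_if split: if_splits)
    ultimately have "t' \<in> (\<lambda>(\<sigma>, d). of_int \<sigma> / of_int d) ` ({- 1, 1 :: int} \<times> {0<..D})"
      by (force simp: image_iff)
    then show ?thesis using t' by (auto simp: Z_def F_def)
  qed
  have Z: "(f ^^ (n + 2)) \<alpha> \<in> Z" for n
    by (induction n) (use 2 ZF in \<open>auto simp: numeral_2_eq_2\<close>)
  \<comment> \<open>One step reduces the iterate, the second removes its rational part, the third
    bounds the denominator; then the pigeonhole principle applies.\<close>
  have "(f ^^ (n + 3)) \<alpha> \<in> F" for n
    using ZF[OF Z[of n]] by (simp add: numeral_3_eq_3 numeral_2_eq_2)
  then have "range (\<lambda>n. (f ^^ (n + 3)) \<alpha>) \<subseteq> F" by blast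
  moreover have "finite F" by (simp add: F_def)
  ultimately have "\<not> inj (\<lambda>n. (f ^^ (n + 3)) \<alpha>)"
    using finite_subset range_inj_infinite by blast
  then obtain m n where "(f ^^ (m + 3)) \<alpha> = (f ^^ (n + 3)) \<alpha>" "m \<noteq> n" by (auto simp: inj_def)
  then have "\<exists>m1 m2. m1 < m2 \<and> (f ^^ m1) \<alpha> = (f ^^ m2) \<alpha>"
    by (metis add_less_cancel_right linorder_neqE_nat)
  then show ?thesis unfolding f_def \<alpha>_def .
qed

end

theorem theorem2:
  fixes K :: "'p::prime_index padic set" and z :: "'p padic" and \<epsilon> :: int
  assumes "is_subfield K" and "rat_dim K = 2"
    and "z \<in> K" and "condition_H z" and "K = rat_adjoin z"
    and "\<epsilon> \<in> {- 1, 1}"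
  shows "(\<forall>\<alpha>\<in>\<rat>. \<exists>m. (cf_map \<epsilon> z ^^ m) \<alpha> = 0) \<and>
         (\<forall>\<alpha>\<in>K. \<alpha> \<notin> \<rat> \<longrightarrow> (\<exists>m1 m2. m1 < m2 \<and> (cf_map \<epsilon> z ^^ m1) \<alpha> = (cf_map \<epsilon> z ^^ m2) \<alpha>))"
proof -
  have irr: "z \<notin> \<rat>" using assms(4) by (simp add: condition_H_def)
  have one: "1 \<in> K" and "z * z \<in> K" using assms(1,3) by (auto simp: is_subfield_def)
  \<comment> \<open>The coordinates of z * z supply the quadratic relation whose coefficients
    \<open>min_poly\<close> must have.\<close>
  then obtain c d where "z * z = of_rat c + of_rat d * z"
    using quadratic_field_basis[OF assms(2,3) one irr] by blast
  then have root: "z\<^sup>2 + of_rat (- d) * z + of_rat (- c) = 0"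
    by (simp add: power2_eq_square of_rat_minus)
  have mp: "min_poly z = [:- c, - d, 1:]" by (rule min_poly_quadratic[OF irr root])
  obtain x where x: "z = of_nat CARD('p) * x" "x \<in> padic_integers"
    using assms(4) by (auto simp: condition_H_def)
  have "padic_norm z \<le> inverse (real CARD('p))"
    using x(2) CARD_gt_1[where ?'p='p]
    by (simp add: x(1) padic_norm_mult padic_norm_CARD flip: padic_norm_le_1_iff_ord)
  also have "\<dots> < 1" using CARD_gt_1[where ?'p='p] by (simp add: field_simps)
  finally have nz: "padic_norm z < 1" .
  have "padic_norm (of_rat (- d) :: 'p padic) = 1"
    using assms(4) unfolding condition_H_def mp by (intro padic_norm_eq_1_if_ord_0) simp
  then interpret quadratic_padic z "- d" "- c" \<epsilon>
    using irr root nz assms(6) by unfold_locales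
  show ?thesis
  proof (intro conjI ballI impI)
    fix \<alpha> :: "'p padic" assume "\<alpha> \<in> \<rat>"
    \<comment> \<open>Zero needs no step, and any other rational reaches 0 in one.\<close>
    then have "(cf_map \<epsilon> z ^^ (if \<alpha> = 0 then 0 else 1)) \<alpha> = 0" using cf_map_rational by simp
    then show "\<exists>m. (cf_map \<epsilon> z ^^ m) \<alpha> = 0" by blast
  next
    fix \<alpha> assume \<alpha>: "\<alpha> \<in> K" "\<alpha> \<notin> \<rat>"
    obtain s t where st: "\<alpha> = of_rat s + of_rat t * z"
      using quadratic_field_basis[OF assms(2,3) one irr \<alpha>(1)] by blast
    then have "t \<noteq> 0" using \<alpha>(2) by auto
    then show "\<exists>m1 m2. m1 < m2 \<and> (cf_map \<epsilon> z ^^ m1) \<alpha> = (cf_map \<epsilon> z ^^ m2) \<alpha>"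
      unfolding st by (rule orbit_periodic)
  qed
qed

end
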